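(* Let $(\mathbb{X},\perp)$ be a finitely disjoint $\perp$-restriction category. Then $\mathsf{MAT}[(\mathbb{X},\perp)]$ is an extensive restriction category, and furthermore: (i) all finite $\perp_d$-joins in $\mathsf{MAT}[(\mathbb{X},\perp)]$ are strong, so $\mathsf{MAT}[(\mathbb{X},\perp)]$ is also a finitely disjoint $\perp_d$-restriction category; (ii) for matrices $F$, $G$ with the same domain, $F\perp_d G$ if and only if $F_{i,j}\perp G_{i,k}$ for all $i,j,k$; (iii) if $F_1,\dots,F_N$ are pairwise $\perp_d$-disjoint parallel $n\times m$ matrices, then $\bigsqcup_{k=1}^N F_k=\big[\bigsqcup_{k=1}^N (F_k)_{i,j}\big]_{1\le i\le n,\,1\le j\le m}$. Furthermore $\mathcal{I}:(\mathbb{X},\perp)\to(\mathsf{MAT}[(\mathbb{X},\perp)],\perp_d)$, defined on objects by $\mathcal{I}(A)=(A)$ and on maps by the $1\times1$ matrix $\mathcal{I}(f)=[f]$, is a finitely disjoint interference restriction functor.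
   Context: Composition is diagrammatic: $fg$ means first $f$, then $g$. A restriction category is a category with an operator sending each $f:A\to B$ to $\overline{f}:A\to A$ such that $\overline{f}f=f$; $\overline{f}\,\overline{g}=\overline{g}\,\overline{f}$ and $\overline{\overline{g}f}=\overline{g}\,\overline{f}$ for $f:A\to B$, $g:A\to C$; and $f\overline{g}=\overline{fg}f$ for $f:A\to B$, $g:B\to C$. For parallel $f,g$: $f\le g$ iff $\overline{f}g=f$. A map $f:A\to B$ is total if $\overline{f}=1_A$. Restriction zeroes: maps $0:A\to B$ with $f0=0=0f$ and $\overline{0}=0$. An interference relation $\perp$ on a restriction category with restriction zeroes is a family of relations between maps with the same domain such that: $1_A\perp 0$; $f\perp g\Rightarrow g\perp f$; $f\perp f\Rightarrow f=0$; $f'\perp g'$, $f\le f'$, $g\le g'$ imply $f\perp g$; $f\perp g\Rightarrow hfk\perp hgk'$ for all composable $h,k,k'$; $f\perp g\Rightarrow\overline{f}\perp\overline{g}$. A $\perp$-restriction category is a restriction category with restriction zeroes and a chosen interference relation $\perp$. The $\perp$-join $\bigsqcup_if_i$ of a family of parallel maps with $f_i\perp f_j$ for $i\neq j$ is their least upper bound for $\le$; it is strong if $f_i\perp h$ for all $i$ implies $\bigsqcup_if_i\perp h$. A finitely disjoint $\perp$-restriction category is one in which every finite pairwise $\perp$-disjoint family of parallel maps has a $\perp$-join, $h\bigsqcup_if_i=\bigsqcup_ihf_i$ for all composable $h$, and every finite $\perp$-join is strong. (The empty join is $0$.) A finitely disjoint interference restriction functor is a functor preserving restrictions, restriction zeroes,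 the interference relation ($f\perp g\Rightarrow\mathcal{F}(f)\perp\mathcal{F}(g)$), and finite disjoint joins. A coCartesian restriction category is a restriction category with finite coproducts whose injections $\iota_j$ are total. With restriction zeroes, $\iota_j^\circ:A_1+\dots+A_n\to A_j$ is the unique map with $\iota_j\iota_j^\circ=1_{A_j}$ and $\iota_i\iota_j^\circ=0$ for $i\ne j$; $\nabla$ is the codiagonal. An extensive restriction category is a coCartesian restriction category with restriction zeroes such that for every $f:A\to B_1+\dots+B_n$ there is a (necessarily unique) map $\langle f\rangle:A\to A+\dots+A$ ($n$ copies) with $\overline{f}=\langle f\rangle\nabla$ and $\langle f\rangle(f+\dots+f)=f(\iota_1+\dots+\iota_n)$. A map $d:A\to A+\dots+A$ is a decision if $\langle d\rangle=d$. In an extensive restriction category, for $f:A\to B$, $g:A\to C$, $f\perp_d g$ iff there is a decision $d:A\to A+A$ with $d\iota_1^\circ=\overline{f}$, $d\iota_2^\circ=\overline{g}$; this is an interference relation. $\mathsf{MAT}[(\mathbb{X},\perp)]$: objects are finite lists $(A_1,\dots,A_n)$ of objects of $\mathbb{X}$, including the empty list; a map $F:(A_1,\dots,A_n)\to(B_1,\dots,B_m)$ is an $n\times m$ matrix of maps $F_{i,j}:A_i\to B_j$ with $F_{i,j}\perp F_{i,j'}$ for all $i$ and all $j\ne j'$; identities are diagonal matrices of identities (zeroes elsewhere); composition of $F$ with $G:(B_1,\dots,B_m)\to(C_1,\dots,C_p)$ is $(FG)_{i,k}=\bigsqcup_{j=1}^mF_{i,j}G_{j,k}$; $\overline{F}$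 is the diagonal matrix with $\overline{F}_{i,i}=\bigsqcup_{j=1}^m\overline{F_{i,j}}$; coproducts are concatenation of lists, with injections the evident matrices having identities in the corresponding block and zeroes elsewhere; restriction zero maps are matrices of zeroes, and the zero object is the empty list. *)

theory Defs
  imports "Jordan_Normal_Form.Matrix"
begin

section \<open>Restriction categories\<close>

text \<open>Composition is diagrammatic: \<open>f \<cdot> g\<close> is first \<open>f\<close>, then \<open>g\<close>.\<close>

record ('o, 'm) rcat =
  obj :: "'o set"
  arr :: "'m set"
  src :: "'m \<Rightarrow> 'o"
  tgt :: "'m \<Rightarrow> 'o"
  ide :: "'o \<Rightarrow> 'm"
  cmp :: "'m \<Rightarrow> 'm \<Rightarrow> 'm" (infixl "\<cdot>\<index>" 70)
  rst :: "'m \<Rightarrow> 'm"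

record ('o, 'm) zcat = "('o, 'm) rcat" +
  zer :: "'o \<Rightarrow> 'o \<Rightarrow> 'm"

text \<open>\<open>injn C As j\<close> is the \<open>j\<close>-th injection (counting from 0) into \<open>coprod C As\<close>.\<close>

record ('o, 'm) ccat = "('o, 'm) zcat" +
  coprod :: "'o list \<Rightarrow> 'o"
  injn :: "'o list \<Rightarrow> nat \<Rightarrow> 'm"

definition maps :: "('o, 'm, 'x) rcat_scheme \<Rightarrow> 'o \<Rightarrow> 'o \<Rightarrow> 'm set" where
  "maps C A B = {f \<in> arr C. src C f = A \<and> tgt C f = B}"

locale category =
  fixes C :: "('o, 'm, 'x) rcat_scheme" (structure)
  assumes src_obj: "f \<in> arr C \<Longrightarrow> src C f \<in> obj C"
    and tgt_obj: "f \<in> arr C \<Longrightarrow> tgt C f \<in> obj C"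
    and ide_maps: "A \<in> obj C \<Longrightarrow> ide C A \<in> maps C A A"
    and cmp_maps: "f \<in> maps C A B \<Longrightarrow> g \<in> maps C B D \<Longrightarrow> f \<cdot> g \<in> maps C A D"
    and ide_left: "f \<in> maps C A B \<Longrightarrow> ide C A \<cdot> f = f"
    and ide_right: "f \<in> maps C A B \<Longrightarrow> f \<cdot> ide C B = f"
    and cmp_assoc: "f \<in> maps C A B \<Longrightarrow> g \<in> maps C B D \<Longrightarrow> h \<in> maps C D E \<Longrightarrow>
        f \<cdot> g \<cdot> h = f \<cdot> (g \<cdot> h)"

locale restriction_category = category +
  assumes rst_maps: "f \<in> maps C A B \<Longrightarrow> rst C f \<in> maps C A A"
    and rst_cmp: "f \<in> maps C A B \<Longrightarrow> rst C f \<cdot> f = f"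
    and rst_commute: "f \<in> maps C A B \<Longrightarrow> g \<in> maps C A D \<Longrightarrow>
        rst C f \<cdot> rst C g = rst C g \<cdot> rst C f"
    and rst_rst_cmp: "f \<in> maps C A B \<Longrightarrow> g \<in> maps C A D \<Longrightarrow>
        rst C (rst C g \<cdot> f) = rst C g \<cdot> rst C f"
    and cmp_rst: "f \<in> maps C A B \<Longrightarrow> g \<in> maps C B D \<Longrightarrow>
        f \<cdot> rst C g = rst C (f \<cdot> g) \<cdot> f"

definition rle :: "('o, 'm, 'x) rcat_scheme \<Rightarrow> 'm \<Rightarrow> 'm \<Rightarrow> bool" where
  "rle C f g \<longleftrightarrow> f \<in> arr C \<and> g \<in> maps C (src C f) (tgt C f) \<and> rst C f \<cdot>\<^bsub>C\<^esub> g = f"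

definition total_map :: "('o, 'm, 'x) rcat_scheme \<Rightarrow> 'm \<Rightarrow> bool" where
  "total_map C f \<longleftrightarrow> f \<in> arr C \<and> rst C f = ide C (src C f)"

locale restriction_category_zeroes = restriction_category C
  for C :: "('o, 'm, 'x) zcat_scheme" (structure) +
  assumes zer_maps: "A \<in> obj C \<Longrightarrow> B \<in> obj C \<Longrightarrow> zer C A B \<in> maps C A B"
    and cmp_zer: "f \<in> maps C A B \<Longrightarrow> D \<in> obj C \<Longrightarrow> f \<cdot> zer C B D = zer C A D"
    and zer_cmp: "f \<in> maps C A B \<Longrightarrow> D \<in> obj C \<Longrightarrow> zer C D A \<cdot> f = zer C D B"
    and rst_zer: "A \<in> obj C \<Longrightarrow> B \<in> obj C \<Longrightarrow> rst C (zer C A B) = zer C A A"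


section \<open>Interference relations and disjoint joins\<close>

locale perp_restriction_category = restriction_category_zeroes C
  for C :: "('o, 'm, 'x) zcat_scheme" (structure)
    and perp :: "'m \<Rightarrow> 'm \<Rightarrow> bool" (infix "\<perp>" 50) +
  assumes perp_same_src: "f \<perp> g \<Longrightarrow> f \<in> arr C \<and> g \<in> arr C \<and> src C f = src C g"
    and ide_perp_zer: "A \<in> obj C \<Longrightarrow> B \<in> obj C \<Longrightarrow> ide C A \<perp> zer C A B"
    and perp_sym: "f \<perp> g \<Longrightarrow> g \<perp> f"
    and perp_self: "f \<perp> f \<Longrightarrow> f = zer C (src C f) (tgt C f)"
    and perp_down: "f' \<perp> g' \<Longrightarrow> rle C f f' \<Longrightarrow> rle C g g' \<Longrightarrow> f \<perp> g"
    and perp_cmp: "f \<perp> g \<Longrightarrow> h \<in> maps C A' (src C f) \<Longrightarrow>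
        k \<in> maps C (tgt C f) B \<Longrightarrow> k' \<in> maps C (tgt C g) B' \<Longrightarrow>
        h \<cdot> f \<cdot> k \<perp> h \<cdot> g \<cdot> k'"
    and perp_rst: "f \<perp> g \<Longrightarrow> rst C f \<perp> rst C g"

text \<open>A finite family of parallel maps \<open>A \<rightarrow> B\<close> is given by \<open>f i\<close> for \<open>i < n\<close>; the hom-set is
  kept explicit because of the empty family.\<close>

definition perp_family ::
  "('o, 'm, 'x) rcat_scheme \<Rightarrow> ('m \<Rightarrow> 'm \<Rightarrow> bool) \<Rightarrow> 'o \<Rightarrow> 'o \<Rightarrow> nat \<Rightarrow> (nat \<Rightarrow> 'm) \<Rightarrow> bool" where
  "perp_family C perp A B n f \<longleftrightarrow> A \<in> obj C \<and> B \<in> obj C \<and> (\<forall>i<n. f i \<in> maps C A B) \<and>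
    (\<forall>i<n. \<forall>j<n. i \<noteq> j \<longrightarrow> perp (f i) (f j))"

definition is_join ::
  "('o, 'm, 'x) rcat_scheme \<Rightarrow> 'o \<Rightarrow> 'o \<Rightarrow> nat \<Rightarrow> (nat \<Rightarrow> 'm) \<Rightarrow> 'm \<Rightarrow> bool" where
  "is_join C A B n f s \<longleftrightarrow> s \<in> maps C A B \<and> (\<forall>i<n. rle C (f i) s) \<and>
    (\<forall>u\<in>maps C A B. (\<forall>i<n. rle C (f i) u) \<longrightarrow> rle C s u)"

definition djoin ::
  "('o, 'm, 'x) rcat_scheme \<Rightarrow> 'o \<Rightarrow> 'o \<Rightarrow> nat \<Rightarrow> (nat \<Rightarrow> 'm) \<Rightarrow> 'm" where
  "djoin C A B n f = (THE s. is_join C A B n f s)"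

definition strong_join ::
  "('o, 'm, 'x) rcat_scheme \<Rightarrow> ('m \<Rightarrow> 'm \<Rightarrow> bool) \<Rightarrow> 'o \<Rightarrow> nat \<Rightarrow> (nat \<Rightarrow> 'm) \<Rightarrow> 'm \<Rightarrow> bool" where
  "strong_join C perp A n f s \<longleftrightarrow>
    (\<forall>h\<in>arr C. src C h = A \<longrightarrow> (\<forall>i<n. perp (f i) h) \<longrightarrow> perp s h)"

locale finitely_disjoint_restriction_category = perp_restriction_category +
  assumes join_exists: "perp_family C perp A B n f \<Longrightarrow> \<exists>s. is_join C A B n f s"
    and cmp_join: "perp_family C perp A B n f \<Longrightarrow> h \<in> maps C A' A \<Longrightarrow>
        h \<cdot> djoin C A B n f = djoin C A' B n (\<lambda>i. h \<cdot> f i)"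
    and join_strong: "perp_family C perp A B n f \<Longrightarrow> is_join C A B n f s \<Longrightarrow>
        strong_join C perp A n f s"

locale finitely_disjoint_interference_functor =
  C: finitely_disjoint_restriction_category C perpC +
  D: finitely_disjoint_restriction_category D perpD
  for C :: "('o, 'm, 'x) zcat_scheme" and perpC :: "'m \<Rightarrow> 'm \<Rightarrow> bool"
    and D :: "('p, 'n, 'y) zcat_scheme" and perpD :: "'n \<Rightarrow> 'n \<Rightarrow> bool"
    and Fo :: "'o \<Rightarrow> 'p" and Fm :: "'m \<Rightarrow> 'n" +
  assumes obj_pres: "A \<in> obj C \<Longrightarrow> Fo A \<in> obj D"
    and maps_pres: "f \<in> maps C A B \<Longrightarrow> Fm f \<in> maps D (Fo A) (Fo B)"
    and ide_pres: "A \<in> obj C \<Longrightarrow> Fm (ide C A) = ide D (Fo A)"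
    and cmp_pres: "f \<in> maps C A B \<Longrightarrow> g \<in> maps C B E \<Longrightarrow>
        Fm (f \<cdot>\<^bsub>C\<^esub> g) = Fm f \<cdot>\<^bsub>D\<^esub> Fm g"
    and rst_pres: "f \<in> arr C \<Longrightarrow> Fm (rst C f) = rst D (Fm f)"
    and zer_pres: "A \<in> obj C \<Longrightarrow> B \<in> obj C \<Longrightarrow> Fm (zer C A B) = zer D (Fo A) (Fo B)"
    and perp_pres: "perpC f g \<Longrightarrow> perpD (Fm f) (Fm g)"
    and join_pres: "perp_family C perpC A B n fs \<Longrightarrow>
        Fm (djoin C A B n fs) = djoin D (Fo A) (Fo B) n (\<lambda>i. Fm (fs i))"


section \<open>Extensive restriction categories\<close>

locale cocartesian_restriction_category = restriction_category C
  for C :: "('o, 'm, 'x) ccat_scheme" (structure) +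
  assumes coprod_obj: "set As \<subseteq> obj C \<Longrightarrow> coprod C As \<in> obj C"
    and injn_maps: "set As \<subseteq> obj C \<Longrightarrow> j < length As \<Longrightarrow>
        injn C As j \<in> maps C (As ! j) (coprod C As)"
    and coprod_universal: "set As \<subseteq> obj C \<Longrightarrow> B \<in> obj C \<Longrightarrow>
        (\<And>j. j < length As \<Longrightarrow> f j \<in> maps C (As ! j) B) \<Longrightarrow>
        \<exists>!h. h \<in> maps C (coprod C As) B \<and> (\<forall>j<length As. injn C As j \<cdot> h = f j)"
    and injn_total: "set As \<subseteq> obj C \<Longrightarrow> j < length As \<Longrightarrow> total_map C (injn C As j)"

definition copair ::
  "('o, 'm, 'x) ccat_scheme \<Rightarrow> 'o list \<Rightarrow> 'o \<Rightarrow> (nat \<Rightarrow> 'm) \<Rightarrow> 'm" where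
  "copair C As B f =
    (THE h. h \<in> maps C (coprod C As) B \<and> (\<forall>j<length As. injn C As j \<cdot>\<^bsub>C\<^esub> h = f j))"

definition codiag :: "('o, 'm, 'x) ccat_scheme \<Rightarrow> nat \<Rightarrow> 'o \<Rightarrow> 'm" where
  "codiag C n A = copair C (replicate n A) A (\<lambda>_. ide C A)"

definition summap ::
  "('o, 'm, 'x) ccat_scheme \<Rightarrow> 'o list \<Rightarrow> 'o list \<Rightarrow> (nat \<Rightarrow> 'm) \<Rightarrow> 'm" where
  "summap C As Bs f = copair C As (coprod C Bs) (\<lambda>j. f j \<cdot>\<^bsub>C\<^esub> injn C Bs j)"

definition quasiproj :: "('o, 'm, 'x) ccat_scheme \<Rightarrow> 'o list \<Rightarrow> nat \<Rightarrow> 'm" where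
  "quasiproj C As j =
    copair C As (As ! j) (\<lambda>i. if i = j then ide C (As ! j) else zer C (As ! i) (As ! j))"

text \<open>The list \<open>Bs\<close> is an argument of \<open>dec\<close> because \<open>coprod C\<close> need not be injective, so that
  \<open>f : A \<rightarrow> coprod C Bs\<close> does not determine the decomposition of its codomain.\<close>

definition is_dec :: "('o, 'm, 'x) ccat_scheme \<Rightarrow> 'o list \<Rightarrow> 'm \<Rightarrow> 'm \<Rightarrow> bool" where
  "is_dec C Bs f h \<longleftrightarrow>
    (let A = src C f; B = coprod C Bs; n = length Bs in
      h \<in> maps C A (coprod C (replicate n A)) \<and>
      rst C f = h \<cdot>\<^bsub>C\<^esub> codiag C n A \<and>
      h \<cdot>\<^bsub>C\<^esub> summap C (replicate n A) (replicate n B) (\<lambda>_. f) =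
        f \<cdot>\<^bsub>C\<^esub> summap C Bs (replicate n B) (\<lambda>j. injn C Bs j))"

definition dec :: "('o, 'm, 'x) ccat_scheme \<Rightarrow> 'o list \<Rightarrow> 'm \<Rightarrow> 'm" where
  "dec C Bs f = (THE h. is_dec C Bs f h)"

locale extensive_restriction_category =
  cocartesian_restriction_category C + restriction_category_zeroes C
  for C :: "('o, 'm, 'x) ccat_scheme" (structure) +
  assumes dec_exists: "set Bs \<subseteq> obj C \<Longrightarrow> f \<in> maps C A (coprod C Bs) \<Longrightarrow>
    \<exists>!h. is_dec C Bs f h"

definition decision :: "('o, 'm, 'x) ccat_scheme \<Rightarrow> 'o \<Rightarrow> nat \<Rightarrow> 'm \<Rightarrow> bool" where
  "decision C A n d \<longleftrightarrow>
    d \<in> maps C A (coprod C (replicate n A)) \<and> dec C (replicate n A) d = d"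

definition perp_d :: "('o, 'm, 'x) ccat_scheme \<Rightarrow> 'm \<Rightarrow> 'm \<Rightarrow> bool" where
  "perp_d C f g \<longleftrightarrow> f \<in> arr C \<and> g \<in> arr C \<and> src C f = src C g \<and>
    (\<exists>d. decision C (src C f) 2 d \<and>
      d \<cdot>\<^bsub>C\<^esub> quasiproj C [src C f, src C f] 0 = rst C f \<and>
      d \<cdot>\<^bsub>C\<^esub> quasiproj C [src C f, src C f] 1 = rst C g)"


section \<open>The matrix construction\<close>

text \<open>Domain and codomain lists are stored because they are not determined by the entries when
  the matrix has no rows or no columns. Rows and columns are indexed from 0.\<close>

datatype ('o, 'm) mmap = MMap (msrc: "'o list") (mtgt: "'o list") (ment: "'m mat")

definition mk_mmap :: "'o list \<Rightarrow> 'o list \<Rightarrow> (nat \<Rightarrow> nat \<Rightarrow> 'm) \<Rightarrow> ('o, 'm) mmap" where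
  "mk_mmap As Bs f = MMap As Bs (mat (length As) (length Bs) (\<lambda>(i, j). f i j))"

abbreviation entry :: "('o, 'm) mmap \<Rightarrow> nat \<Rightarrow> nat \<Rightarrow> 'm" where
  "entry F i j \<equiv> ment F $$ (i, j)"

definition mmap_arr ::
  "('o, 'm, 'x) zcat_scheme \<Rightarrow> ('m \<Rightarrow> 'm \<Rightarrow> bool) \<Rightarrow> ('o, 'm) mmap set" where
  "mmap_arr X perp = {F. set (msrc F) \<subseteq> obj X \<and> set (mtgt F) \<subseteq> obj X \<and>
    ment F \<in> carrier_mat (length (msrc F)) (length (mtgt F)) \<and>
    (\<forall>i<length (msrc F). \<forall>j<length (mtgt F). entry F i j \<in> maps X (msrc F ! i) (mtgt F ! j)) \<and>
    (\<forall>i<length (msrc F). \<forall>j<length (mtgt F). \<forall>j'<length (mtgt F).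
      j \<noteq> j' \<longrightarrow> perp (entry F i j) (entry F i j'))}"

definition diag_mmap :: "('o, 'm, 'x) zcat_scheme \<Rightarrow> 'o list \<Rightarrow> (nat \<Rightarrow> 'm) \<Rightarrow> ('o, 'm) mmap" where
  "diag_mmap X As f = mk_mmap As As (\<lambda>i j. if i = j then f i else zer X (As ! i) (As ! j))"

definition mmap_cmp ::
  "('o, 'm, 'x) zcat_scheme \<Rightarrow> ('o, 'm) mmap \<Rightarrow> ('o, 'm) mmap \<Rightarrow> ('o, 'm) mmap" where
  "mmap_cmp X F G = mk_mmap (msrc F) (mtgt G) (\<lambda>i k.
    djoin X (msrc F ! i) (mtgt G ! k) (length (mtgt F)) (\<lambda>j. entry F i j \<cdot>\<^bsub>X\<^esub> entry G j k))"

definition mmap_rst :: "('o, 'm, 'x) zcat_scheme \<Rightarrow> ('o, 'm) mmap \<Rightarrow> ('o, 'm) mmap" where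
  "mmap_rst X F = diag_mmap X (msrc F) (\<lambda>i.
    djoin X (msrc F ! i) (msrc F ! i) (length (mtgt F)) (\<lambda>j. rst X (entry F i j)))"

text \<open>The block of the \<open>j\<close>-th summand in \<open>concat Ls\<close> starts at column
  \<open>length (concat (take j Ls))\<close>.\<close>

definition mmap_injn ::
  "('o, 'm, 'x) zcat_scheme \<Rightarrow> 'o list list \<Rightarrow> nat \<Rightarrow> ('o, 'm) mmap" where
  "mmap_injn X Ls j = mk_mmap (Ls ! j) (concat Ls) (\<lambda>r c.
    if c = length (concat (take j Ls)) + r then ide X (Ls ! j ! r)
    else zer X (Ls ! j ! r) (concat Ls ! c))"

definition MAT ::
  "('o, 'm, 'x) zcat_scheme \<Rightarrow> ('m \<Rightarrow> 'm \<Rightarrow> bool) \<Rightarrow> ('o list, ('o, 'm) mmap) ccat" where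
  "MAT X perp =
    \<lparr>obj = {As. set As \<subseteq> obj X},
     arr = mmap_arr X perp,
     src = msrc,
     tgt = mtgt,
     ide = (\<lambda>As. diag_mmap X As (\<lambda>i. ide X (As ! i))),
     cmp = mmap_cmp X,
     rst = mmap_rst X,
     zer = (\<lambda>As Bs. mk_mmap As Bs (\<lambda>i j. zer X (As ! i) (Bs ! j))),
     coprod = concat,
     injn = mmap_injn X\<rparr>"

definition incl_map :: "('o, 'm, 'x) zcat_scheme \<Rightarrow> 'm \<Rightarrow> ('o, 'm) mmap" where
  "incl_map X f = mk_mmap [src X f] [tgt X f] (\<lambda>_ _. f)"

end

theory Submission
  imports Defs
begin

text \<open>
  In a finitely disjoint restriction category, restriction and composition on either side preserve
  disjoint joins; for postcomposition this follows by comparing restrictions, since two maps with a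
  common upper bound agree as soon as their restrictions do. Because finite joins are strong, the
  entries of a matrix product are again disjoint along rows, and associativity is an interchange of
  joins. In row \<open>i\<close>, the restriction of a matrix \<open>F\<close> is the idempotent \<open>r\<^sub>i(F) = \<Squnion>\<^sub>j rst F\<^sub>i\<^sub>j\<close>, and
  disjointness along the row makes \<open>\<le>\<close> entrywise. The decision of \<open>F : A \<rightarrow> B\<^sub>1 + \<dots> + B\<^sub>n\<close> is forced
  to consist of \<open>n\<close> diagonal blocks, the \<open>k\<close>-th one joining the restrictions of the entries in the
  columns of \<open>B\<^sub>k\<close>. Hence \<open>F \<perp>\<^sub>d G\<close> holds iff \<open>r\<^sub>i(F) \<perp> r\<^sub>i(G)\<close> for all \<open>i\<close>, which by strength is
  entrywise disjointness, and joins of matrices are computed entrywise.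
\<close>

section \<open>Joins in finitely disjoint restriction categories\<close>

text \<open>Nearly every matrix identity comes down to one cancellation: if \<open>f\<close> and
  \<open>g\<close> are disjoint then \<open>rst C f \<cdot> g\<close> is zero. A row idempotent can
  exceed the restriction of a single entry; the axiom \<open>cmp_rst\<close>, the order and the
  decision equations each need the excess to act as zero on that entry, which is what disjointness
  along rows provides.

  The hypotheses give distributivity of joins for precomposition only, while associativity of the
  matrix product needs both sides; hence the work on postcomposition. Equations between joins are
  proved by exhibiting both sides as \<open>is_join\<close> of the same family, so the definite
  description in \<open>djoin\<close> is rarely unfolded.

  The two decision equations do different work: the codiagonal equation bounds the entries by the
  restriction of \<open>F\<close>, which kills everything off the diagonals of the blocks, and the
  other one fixes what the surviving entries do to the entries of \<open>F\<close>. The interference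
  axioms for \<open>perp_d\<close> are then checked entrywise, without building a decision for
  each.\<close>

context restriction_category
begin

lemma maps_src_obj: "f \<in> maps C A B \<Longrightarrow> A \<in> obj C"
  using src_obj by (auto simp: maps_def)

lemma maps_tgt_obj: "f \<in> maps C A B \<Longrightarrow> B \<in> obj C"
  using tgt_obj by (auto simp: maps_def)

lemma rst_ide: "A \<in> obj C \<Longrightarrow> rst C (ide C A) = ide C A"
  using rst_cmp[OF ide_maps] ide_right[OF rst_maps[OF ide_maps]] by metis

text \<open>The axiom \<open>rst_rst_cmp\<close> applied to \<open>rst C f \<cdot> ide C A\<close>,
  together with totality of the identity.\<close>

lemma rst_idem:
  assumes "f \<in> maps C A B" shows "rst C (rst C f) = rst C f"
proof -
  have A: "A \<in> obj C" using assms by (rule maps_src_obj)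
  have "rst C (rst C f \<cdot> ide C A) = rst C f \<cdot> rst C (ide C A)"
    by (rule rst_rst_cmp[OF ide_maps[OF A] assms])
  then show ?thesis
    using ide_right[OF rst_maps[OF assms]] rst_ide[OF A] by simp
qed

text \<open>Restriction idempotents on \<open>A\<close>: the partial identities, equivalently the
  maps below \<open>ide C A\<close> (\<open>rle_ide_ridem\<close>, \<open>ridem_rle_ide\<close>).
  The second form is what shows that a join of them is one again.\<close>

definition ridem :: "'a \<Rightarrow> 'b \<Rightarrow> bool" where
  "ridem A e \<longleftrightarrow> e \<in> maps C A A \<and> rst C e = e"

lemma ridem_maps: "ridem A e \<Longrightarrow> e \<in> maps C A A"
  by (simp add: ridem_def)

lemma ridem_rst: "f \<in> maps C A B \<Longrightarrow> ridem A (rst C f)"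
  by (auto simp: ridem_def rst_maps rst_idem)

lemma ridem_commute: "ridem A e \<Longrightarrow> ridem A e' \<Longrightarrow> e \<cdot> e' = e' \<cdot> e"
  using rst_commute by (metis ridem_def)

lemma rst_ridem_cmp: "ridem A e \<Longrightarrow> f \<in> maps C A B \<Longrightarrow> rst C (e \<cdot> f) = e \<cdot> rst C f"
  using rst_rst_cmp by (metis ridem_def)

lemma ridem_cmp: "ridem A e \<Longrightarrow> ridem A e' \<Longrightarrow> ridem A (e \<cdot> e')"
  using rst_ridem_cmp cmp_maps by (metis ridem_def)

text \<open>Since \<open>rst C f\<close> is absorbed by \<open>f \<cdot> g\<close>, the domain of
  the composite lies inside that of \<open>f\<close>.\<close>

lemma rst_cmp_le:
  assumes "f \<in> maps C A B" "g \<in> maps C B D"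
  shows "rst C (f \<cdot> g) \<cdot> rst C f = rst C (f \<cdot> g)"
    and "rst C f \<cdot> rst C (f \<cdot> g) = rst C (f \<cdot> g)"
proof -
  have fg: "f \<cdot> g \<in> maps C A D" by (rule cmp_maps[OF assms])
  have "rst C (rst C f \<cdot> (f \<cdot> g)) = rst C f \<cdot> rst C (f \<cdot> g)"
    by (rule rst_rst_cmp[OF fg assms(1)])
  moreover have "rst C f \<cdot> (f \<cdot> g) = f \<cdot> g"
    using cmp_assoc[OF rst_maps[OF assms(1)] assms] rst_cmp[OF assms(1)] by simp
  ultimately show "rst C f \<cdot> rst C (f \<cdot> g) = rst C (f \<cdot> g)" by simp
  then show "rst C (f \<cdot> g) \<cdot> rst C f = rst C (f \<cdot> g)"
    using rst_commute[OF fg assms(1)] by simp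
qed

lemma rst_cmp_rst:
  assumes "f \<in> maps C A B" "g \<in> maps C B D"
  shows "rst C (f \<cdot> rst C g) = rst C (f \<cdot> g)"
  using cmp_rst[OF assms] rst_rst_cmp[OF assms(1) cmp_maps[OF assms]] rst_cmp_le[OF assms] by simp

lemma rle_iff:
  "f \<in> maps C A B \<Longrightarrow> g \<in> maps C A B \<Longrightarrow> rle C f g \<longleftrightarrow> rst C f \<cdot> g = f"
  by (auto simp: rle_def maps_def)

lemma rle_refl: "f \<in> maps C A B \<Longrightarrow> rle C f f"
  using rle_iff rst_cmp by blast

lemma rle_maps: "rle C f g \<Longrightarrow> f \<in> maps C A B \<longleftrightarrow> g \<in> maps C A B"
  by (auto simp: rle_def maps_def)

lemma rle_rst:
  assumes "rle C f g" shows "rst C f \<cdot> rst C g = rst C f" "rle C (rst C f) (rst C g)"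
proof -
  obtain A B where f: "f \<in> maps C A B" using assms by (auto simp: rle_def maps_def)
  then have g: "g \<in> maps C A B" using rle_maps[OF assms] by blast
  show *: "rst C f \<cdot> rst C g = rst C f"
    using rst_rst_cmp[OF g f] assms rle_iff[OF f g] by simp
  show "rle C (rst C f) (rst C g)"
    using * rle_iff[OF rst_maps[OF f] rst_maps[OF g]] rst_idem[OF f] by simp
qed

lemma rle_trans:
  assumes "rle C f g" "rle C g h" shows "rle C f h"
proof -
  obtain A B where f: "f \<in> maps C A B" using assms by (auto simp: rle_def maps_def)
  then have g: "g \<in> maps C A B" using rle_maps[OF assms(1)] by blast
  then have h: "h \<in> maps C A B" using rle_maps[OF assms(2)] by blast
  have "rst C f \<cdot> h = rst C f \<cdot> rst C g \<cdot> h" using rle_rst[OF assms(1)] by simp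
  also have "\<dots> = rst C f \<cdot> (rst C g \<cdot> h)"
    by (rule cmp_assoc[OF rst_maps[OF f] rst_maps[OF g] h])
  also have "\<dots> = f" using assms rle_iff[OF f g] rle_iff[OF g h] by simp
  finally show ?thesis using rle_iff[OF f h] by simp
qed

lemma rle_antisym_rst:
  assumes "rle C f g" "rle C g f" shows "rst C f = rst C g"
proof -
  obtain A B where f: "f \<in> maps C A B" using assms by (auto simp: rle_def maps_def)
  then have g: "g \<in> maps C A B" using rle_maps[OF assms(1)] by blast
  show ?thesis using rle_rst(1)[OF assms(1)] rle_rst(1)[OF assms(2)] rst_commute[OF f g] by simp
qed

text \<open>Each map equals \<open>u\<close> cut down by its own restriction. To identify two maps
  below a common bound it therefore suffices to compare idempotents.\<close>

lemma rle_common_bound: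
  "rle C f u \<Longrightarrow> rle C g u \<Longrightarrow> rst C f = rst C g \<Longrightarrow> f = g"
  by (metis rle_def)

lemma rle_refl_right: "rle C f g \<Longrightarrow> rle C g g"
  using rle_refl by (auto simp: rle_def maps_def)

lemma rle_antisym: "rle C f g \<Longrightarrow> rle C g f \<Longrightarrow> f = g"
  using rle_antisym_rst rle_common_bound rle_refl_right by metis

lemma ridem_cmp_rle:
  assumes "ridem A e" "f \<in> maps C A B" shows "rle C (e \<cdot> f) f"
proof -
  have e: "e \<in> maps C A A" using assms by (simp add: ridem_def)
  have "rst C (e \<cdot> f) \<cdot> f = e \<cdot> (rst C f \<cdot> f)"
    using rst_ridem_cmp[OF assms] cmp_assoc[OF e rst_maps[OF assms(2)] assms(2)] by simp
  then show ?thesis using rle_iff[OF cmp_maps[OF e assms(2)] assms(2)] rst_cmp[OF assms(2)] by simp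
qed

lemma rle_cmp_right:
  assumes "rle C f g" "f \<in> maps C A B" "k \<in> maps C B D"
  shows "rle C (f \<cdot> k) (g \<cdot> k)"
proof -
  have g: "g \<in> maps C A B" using rle_maps[OF assms(1)] assms(2) by blast
  have "f \<cdot> k = rst C f \<cdot> (g \<cdot> k)"
    using assms(1) rle_iff[OF assms(2) g] cmp_assoc[OF rst_maps[OF assms(2)] g assms(3)] by simp
  then show ?thesis using ridem_cmp_rle[OF ridem_rst[OF assms(2)] cmp_maps[OF g assms(3)]] by simp
qed

lemma rle_ide_ridem:
  assumes "rle C e (ide C A)" "A \<in> obj C" shows "ridem A e"
proof -
  have e: "e \<in> maps C A A" using rle_maps[OF assms(1)] ide_maps[OF assms(2)] by blast
  then have "rst C e \<cdot> ide C A = e" using assms rle_iff[OF e ide_maps[OF assms(2)]] by simp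
  then show ?thesis using e ide_right[OF rst_maps[OF e]] by (simp add: ridem_def)
qed

lemma ridem_rle_ide: "ridem A e \<Longrightarrow> rle C e (ide C A)"
  by (metis ide_maps ide_right maps_src_obj ridem_cmp_rle ridem_def)

section \<open>Uniqueness and interchange of joins\<close>

lemma is_join_unique: "is_join C A B n f s \<Longrightarrow> is_join C A B n f t \<Longrightarrow> s = t"
  unfolding is_join_def using rle_antisym by blast

lemma djoin_eq: "is_join C A B n f s \<Longrightarrow> djoin C A B n f = s"
  unfolding djoin_def using is_join_unique by blast

lemma is_join_cong:
  "(\<And>i. i < n \<Longrightarrow> f i = g i) \<Longrightarrow> is_join C A B n f s \<longleftrightarrow> is_join C A B n g s"
  by (auto simp: is_join_def)

lemma is_join_maps: "is_join C A B n f s \<Longrightarrow> s \<in> maps C A B"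
  by (simp add: is_join_def)

lemma is_join_upper: "is_join C A B n f s \<Longrightarrow> i < n \<Longrightarrow> rle C (f i) s"
  by (simp add: is_join_def)

lemma is_join_least:
  "is_join C A B n f s \<Longrightarrow> u \<in> maps C A B \<Longrightarrow> (\<And>i. i < n \<Longrightarrow> rle C (f i) u) \<Longrightarrow> rle C s u"
  by (simp add: is_join_def)

text \<open>Pure order theory: \<open>t\<close> is the least upper bound of the whole array
  \<open>a\<close>, whichever index is joined first. It serves associativity, restrictions of
  products, block restrictions and precomposition with a join of matrices.\<close>

lemma is_join_swap:
  assumes "\<And>k. k < p \<Longrightarrow> is_join C A B m (\<lambda>j. a j k) (s k)"
    and "is_join C A B p s t"
    and "\<And>j. j < m \<Longrightarrow> is_join C A B p (\<lambda>k. a j k) (r j)"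
  shows "is_join C A B m r t"
  unfolding is_join_def
proof (intro conjI allI impI ballI)
  show t: "t \<in> maps C A B" using assms(2) by (rule is_join_maps)
  show "rle C (r j) t" if "j < m" for j
    using is_join_least[OF assms(3)[OF that] t] is_join_upper[OF assms(1) that]
      is_join_upper[OF assms(2)] rle_trans by blast
  show "rle C t u" if u: "u \<in> maps C A B" "\<forall>j<m. rle C (r j) u" for u
  proof (rule is_join_least[OF assms(2) u(1)])
    fix k assume "k < p"
    then show "rle C (s k) u"
      using is_join_least[OF assms(1) u(1)] is_join_upper[OF assms(3)] u(2) rle_trans by blast
  qed
qed

end

section \<open>Joins of families with zero members\<close>

context restriction_category_zeroes
begin

lemma zer_rle: "f \<in> maps C A B \<Longrightarrow> rle C (zer C A B) f"
  using rle_iff zer_maps rst_zer zer_cmp maps_src_obj maps_tgt_obj by metis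

lemma rle_zer:
  assumes "rle C f (zer C A B)" "A \<in> obj C" "B \<in> obj C" shows "f = zer C A B"
  using rle_antisym[OF assms(1)] zer_rle rle_maps[OF assms(1)] zer_maps[OF assms(2,3)] by blast

text \<open>Zero is the least map, so the only member that can be nonzero is the join. This
  evaluates products with diagonal matrices, injections and quasi-projections.\<close>

lemma is_join_single:
  assumes "p < n" "f p = s" "s \<in> maps C A B"
    "\<And>i. i < n \<Longrightarrow> i \<noteq> p \<Longrightarrow> f i = zer C A B"
  shows "is_join C A B n f s"
  unfolding is_join_def using assms zer_rle rle_refl by metis

text \<open>With \<open>n = 0\<close> this is the empty join, which covers products through the
  empty list.\<close>

lemma is_join_zer:
  assumes "A \<in> obj C" "B \<in> obj C" "\<And>i. i < n \<Longrightarrow> f i = zer C A B"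
  shows "is_join C A B n f (zer C A B)"
  unfolding is_join_def using assms zer_rle zer_maps by simp

text \<open>Members outside the range of \<open>q\<close> are zero and lie below every map, so both
  families have the same upper bounds.\<close>

lemma is_join_reindex:
  assumes "\<And>k. k < n \<Longrightarrow> q k < N" "\<And>p. p < N \<Longrightarrow> (\<exists>k<n. p = q k) \<or> f p = zer C A B"
  shows "is_join C A B N f s \<longleftrightarrow> is_join C A B n (\<lambda>k. f (q k)) s"
proof -
  have "(\<forall>p<N. rle C (f p) u) \<longleftrightarrow> (\<forall>k<n. rle C (f (q k)) u)" if "u \<in> maps C A B" for u
    using assms zer_rle[OF that] by metis
  then show ?thesis unfolding is_join_def by blast
qed

end

section \<open>Consequences of the interference axioms\<close>

context perp_restriction_category
begin

lemma perp_cmp_left: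
  assumes "f \<perp> g" "f \<in> maps C A B" "g \<in> maps C A B'" "h \<in> maps C D A"
  shows "h \<cdot> f \<perp> h \<cdot> g"
proof -
  have "h \<cdot> f \<cdot> ide C B \<perp> h \<cdot> g \<cdot> ide C B'"
    using assms perp_cmp[OF assms(1), of h D "ide C B" B "ide C B'" B']
      ide_maps maps_tgt_obj by (auto simp: maps_def)
  then show ?thesis
    using ide_right[OF cmp_maps[OF assms(4,2)]] ide_right[OF cmp_maps[OF assms(4,3)]] by simp
qed

lemma perp_cmp_right:
  assumes "f \<perp> g" "f \<in> maps C A B" "g \<in> maps C A B'" "k \<in> maps C B D" "k' \<in> maps C B' D'"
  shows "f \<cdot> k \<perp> g \<cdot> k'"
proof -
  have "ide C A \<cdot> f \<cdot> k \<perp> ide C A \<cdot> g \<cdot> k'"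
    using assms perp_cmp[OF assms(1), of "ide C A" A k D k' D']
      ide_maps maps_src_obj by (auto simp: maps_def)
  then show ?thesis using ide_left assms(2,3) by metis
qed

text \<open>Postcomposing \<open>ide_perp_zer\<close> with \<open>f\<close> on one side and an
  identity on the other turns the axiom about identities into disjointness of zero from every
  map.\<close>

lemma perp_zer:
  assumes "f \<in> maps C A B" "D \<in> obj C" shows "f \<perp> zer C A D" "zer C A D \<perp> f"
proof -
  have A: "A \<in> obj C" using assms(1) by (rule maps_src_obj)
  have "ide C A \<cdot> f \<perp> zer C A D \<cdot> ide C D"
    using perp_cmp_right[OF ide_perp_zer[OF A assms(2)] ide_maps[OF A] zer_maps[OF A assms(2)]
        assms(1) ide_maps[OF assms(2)]] .
  then show "f \<perp> zer C A D"
    using ide_left[OF assms(1)] ide_right[OF zer_maps[OF A assms(2)]] by simp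
  then show "zer C A D \<perp> f" by (rule perp_sym)
qed

text \<open>Disjointness depends on domains only: one direction is the axiom
  \<open>perp_rst\<close>, the other postcomposes the restrictions with the maps themselves.\<close>

lemma perp_rst_iff:
  assumes "f \<in> maps C A B" "g \<in> maps C A B'"
  shows "rst C f \<perp> rst C g \<longleftrightarrow> f \<perp> g"
  using perp_rst perp_cmp_right[OF _ rst_maps[OF assms(1)] rst_maps[OF assms(2)] assms]
    rst_cmp[OF assms(1)] rst_cmp[OF assms(2)] by auto

text \<open>The overlap \<open>rst C f \<cdot> rst C g\<close> lies below both restrictions, hence
  is disjoint from itself and so zero; multiplying by \<open>g\<close> gives the claim. This
  cancellation removes the cross terms in later computations.\<close>

lemma perp_rst_cmp_zer:
  assumes "f \<perp> g" "f \<in> maps C A B" "g \<in> maps C A D"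
  shows "rst C f \<cdot> g = zer C A D"
proof -
  have A: "A \<in> obj C" using assms(2) by (rule maps_src_obj)
  have f: "ridem A (rst C f)" and g: "ridem A (rst C g)" using ridem_rst assms by blast+
  let ?e = "rst C f \<cdot> rst C g"
  have "rle C ?e (rst C g)" using ridem_cmp_rle[OF f ridem_maps[OF g]] .
  moreover have "rle C ?e (rst C f)"
    using ridem_cmp_rle[OF g ridem_maps[OF f]] ridem_commute[OF f g] by simp
  ultimately have "?e \<perp> ?e" using perp_down[OF perp_rst[OF assms(1)]] by blast
  then have "?e = zer C A A"
    using perp_self ridem_maps[OF ridem_cmp[OF f g]] by (fastforce simp: maps_def)
  then have "zer C A A \<cdot> g = rst C f \<cdot> (rst C g \<cdot> g)"
    using cmp_assoc[OF ridem_maps[OF f] ridem_maps[OF g] assms(3)] by simp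
  then show ?thesis using rst_cmp[OF assms(3)] zer_cmp[OF assms(3) A] by simp
qed

end

section \<open>Disjoint joins under composition, restriction and interference\<close>

context finitely_disjoint_restriction_category
begin

lemma djoin_is_join: "perp_family C perp A B n f \<Longrightarrow> is_join C A B n f (djoin C A B n f)"
  using join_exists djoin_eq by metis

lemma perp_family_objs: "perp_family C perp A B n f \<Longrightarrow> A \<in> obj C \<and> B \<in> obj C"
  by (simp add: perp_family_def)

lemma perp_family_cmp_left:
  assumes "perp_family C perp A B n f" "h \<in> maps C D A"
  shows "perp_family C perp D B n (\<lambda>i. h \<cdot> f i)"
  using assms perp_cmp_left cmp_maps maps_src_obj unfolding perp_family_def by metis

lemma perp_family_cmp_right:
  assumes "perp_family C perp A B n f" "k \<in> maps C B D"
  shows "perp_family C perp A D n (\<lambda>i. f i \<cdot> k)"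
  using assms perp_cmp_right cmp_maps maps_tgt_obj unfolding perp_family_def by metis

lemma perp_family_rst:
  assumes "perp_family C perp A B n f"
  shows "perp_family C perp A A n (\<lambda>i. rst C (f i))"
  using assms perp_rst rst_maps unfolding perp_family_def by metis

lemma is_join_cmp_left:
  assumes "perp_family C perp A B n f" "is_join C A B n f s" "h \<in> maps C D A"
  shows "is_join C D B n (\<lambda>i. h \<cdot> f i) (h \<cdot> s)"
  using cmp_join[OF assms(1,3)] djoin_eq[OF assms(2)]
    djoin_is_join[OF perp_family_cmp_left[OF assms(1,3)]] by simp

text \<open>The join \<open>e\<close> of the restrictions is clearly below \<open>rst C s\<close>.
  Conversely \<open>e \<cdot> s\<close> still bounds every \<open>f i\<close>, so \<open>s\<close>
  lies below it, and taking restrictions puts \<open>rst C s\<close> below \<open>e\<close>.\<close>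

lemma is_join_rst:
  assumes "perp_family C perp A B n f" "is_join C A B n f s"
  shows "is_join C A A n (\<lambda>i. rst C (f i)) (rst C s)"
proof -
  define e where "e = djoin C A A n (\<lambda>i. rst C (f i))"
  have A: "A \<in> obj C" using perp_family_objs[OF assms(1)] by blast
  have s: "s \<in> maps C A B" using assms(2) by (rule is_join_maps)
  have f: "f i \<in> maps C A B" if "i < n" for i using assms(1) that by (simp add: perp_family_def)
  have e: "is_join C A A n (\<lambda>i. rst C (f i)) e"
    unfolding e_def by (rule djoin_is_join[OF perp_family_rst[OF assms(1)]])
  have "rle C e (ide C A)"
    by (rule is_join_least[OF e ide_maps[OF A]]) (use ridem_rle_ide ridem_rst f in blast)
  then have re: "ridem A e" using rle_ide_ridem A by blast
  have le: "rle C e (rst C s)"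
    by (rule is_join_least[OF e rst_maps[OF s]]) (use is_join_upper[OF assms(2)] rle_rst in blast)
  have es: "e \<cdot> s \<in> maps C A B" using cmp_maps[OF ridem_maps[OF re] s] .
  have "rle C s (e \<cdot> s)"
  proof (rule is_join_least[OF assms(2) es])
    fix i assume i: "i < n"
    have "rle C (rst C (f i) \<cdot> s) (e \<cdot> s)"
      using rle_cmp_right[OF is_join_upper[OF e i] rst_maps[OF f[OF i]] s] .
    then show "rle C (f i) (e \<cdot> s)"
      using is_join_upper[OF assms(2) i] rle_iff[OF f[OF i] s] by simp
  qed
  then have "rle C (rst C s) (rst C (e \<cdot> s))" by (rule rle_rst)
  then have "rle C (rst C s) (e \<cdot> rst C s)" using rst_ridem_cmp[OF re s] by simp
  moreover have "e \<cdot> rst C s = e"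
    using le rle_iff[OF ridem_maps[OF re] rst_maps[OF s]] re by (simp add: ridem_def)
  ultimately have "rst C s = e" using le rle_antisym by simp
  then show ?thesis using e by simp
qed

text \<open>Distributivity is an axiom for precomposition only. Precomposing the family with the
  idempotent \<open>rst C (s \<cdot> k)\<close> brings the domain of the composite within reach of
  that axiom, and \<open>is_join_rst\<close> then computes the restriction of the join of the
  \<open>f i \<cdot> k\<close>.\<close>

lemma is_join_cmp_right:
  assumes "perp_family C perp A B n f" "is_join C A B n f s" "k \<in> maps C B D"
  shows "is_join C A D n (\<lambda>i. f i \<cdot> k) (s \<cdot> k)"
proof -
  define t where "t = djoin C A D n (\<lambda>i. f i \<cdot> k)"
  have s: "s \<in> maps C A B" using assms(2) by (rule is_join_maps)
  have f: "f i \<in> maps C A B" if "i < n" for i using assms(1) that by (simp add: perp_family_def)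
  have pk: "perp_family C perp A D n (\<lambda>i. f i \<cdot> k)"
    by (rule perp_family_cmp_right[OF assms(1,3)])
  have t: "is_join C A D n (\<lambda>i. f i \<cdot> k) t"
    unfolding t_def by (rule djoin_is_join[OF pk])
  have sk: "s \<cdot> k \<in> maps C A D" using cmp_maps[OF s assms(3)] .
  have le: "rle C t (s \<cdot> k)"
    by (rule is_join_least[OF t sk])
      (use is_join_upper[OF assms(2)] rle_cmp_right[OF _ f assms(3)] in blast)
  let ?e = "rst C (s \<cdot> k)"
  have re: "?e \<in> maps C A A" using rst_maps[OF sk] .
  \<comment> \<open>restricting \<open>f i\<close> to the domain of \<open>s \<cdot> k\<close> amounts to restricting it to that of \<open>f i \<cdot> k\<close>\<close>
  have ef: "rst C (?e \<cdot> f i) = rst C (f i \<cdot> k)" if i: "i < n" for i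
  proof -
    have fi: "f i \<in> maps C A B" and rfi: "rst C (f i) \<cdot> s = f i"
      using f[OF i] is_join_upper[OF assms(2) i] rle_iff[OF f[OF i] s] by auto
    have "rst C (?e \<cdot> f i) = ?e \<cdot> rst C (f i)" by (rule rst_rst_cmp[OF fi sk])
    also have "\<dots> = rst C (f i) \<cdot> ?e" by (rule rst_commute[OF sk fi])
    also have "\<dots> = rst C (rst C (f i) \<cdot> (s \<cdot> k))" by (rule rst_rst_cmp[OF sk fi, symmetric])
    also have "\<dots> = rst C (f i \<cdot> k)"
      using cmp_assoc[OF rst_maps[OF fi] s assms(3)] rfi by simp
    finally show ?thesis .
  qed
  have "is_join C A A n (\<lambda>i. rst C (?e \<cdot> f i)) (rst C (?e \<cdot> s))"
    by (rule is_join_rst[OF perp_family_cmp_left[OF assms(1) re] is_join_cmp_left[OF assms(1,2) re]])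
  moreover have "rst C (?e \<cdot> s) = ?e"
    using rst_rst_cmp[OF s sk] rst_cmp_le[OF s assms(3)] by simp
  ultimately have "is_join C A A n (\<lambda>i. rst C (f i \<cdot> k)) ?e"
    using is_join_cong[of n "\<lambda>i. rst C (?e \<cdot> f i)" "\<lambda>i. rst C (f i \<cdot> k)"] ef by simp
  then have "?e = rst C t" using is_join_unique is_join_rst[OF pk t] by blast
  then have "t = s \<cdot> k" using rle_common_bound[OF le rle_refl[OF sk]] by simp
  then show ?thesis using t by simp
qed

lemma is_join_perp:
  assumes "perp_family C perp A B n f" "is_join C A B n f s" "h \<in> maps C A D"
    "\<And>i. i < n \<Longrightarrow> f i \<perp> h"
  shows "s \<perp> h"
  using join_strong[OF assms(1,2)] assms(3,4) by (auto simp: strong_join_def maps_def)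

text \<open>Strength moves one argument of the relation to its join; it is used twice, with symmetry
  in between.\<close>

lemma is_join_perp_is_join:
  assumes "perp_family C perp A B n f" "is_join C A B n f s"
    "perp_family C perp A D m g" "is_join C A D m g t"
    "\<And>i j. i < n \<Longrightarrow> j < m \<Longrightarrow> f i \<perp> g j"
  shows "s \<perp> t"
proof (rule is_join_perp[OF assms(1,2) is_join_maps[OF assms(4)]])
  fix i assume i: "i < n"
  have "t \<perp> f i"
    by (rule is_join_perp[OF assms(3,4)])
      (use assms(1,5) i perp_sym in \<open>auto simp: perp_family_def\<close>)
  then show "f i \<perp> t" by (rule perp_sym)
qed

end

section \<open>The restriction category of matrices\<close>

lemma MAT_simps [simp]:
  "obj (MAT X p) = {As. set As \<subseteq> obj X}"
  "arr (MAT X p) = mmap_arr X p"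
  "src (MAT X p) = msrc"
  "tgt (MAT X p) = mtgt"
  "ide (MAT X p) As = diag_mmap X As (\<lambda>i. ide X (As ! i))"
  "cmp (MAT X p) = mmap_cmp X"
  "rst (MAT X p) = mmap_rst X"
  "zer (MAT X p) As Bs = mk_mmap As Bs (\<lambda>i j. zer X (As ! i) (Bs ! j))"
  "coprod (MAT X p) = concat"
  "injn (MAT X p) = mmap_injn X"
  by (simp_all add: MAT_def)

lemma mk_mmap_sel [simp]:
  "msrc (mk_mmap As Bs f) = As"
  "mtgt (mk_mmap As Bs f) = Bs"
  "ment (mk_mmap As Bs f) \<in> carrier_mat (length As) (length Bs)"
  by (simp_all add: mk_mmap_def)

lemma entry_mk_mmap [simp]:
  "i < length As \<Longrightarrow> j < length Bs \<Longrightarrow> entry (mk_mmap As Bs f) i j = f i j"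
  by (simp add: mk_mmap_def)

lemma entry_diag_mmap [simp]:
  "i < length As \<Longrightarrow> j < length As \<Longrightarrow>
    entry (diag_mmap X As f) i j = (if i = j then f i else zer X (As ! i) (As ! j))"
  by (simp add: diag_mmap_def)

context finitely_disjoint_restriction_category
begin

section \<open>Rows of pairwise disjoint maps\<close>

abbreviation M :: "('a list, ('a, 'b) mmap) ccat" where
  "M \<equiv> MAT C perp"

text \<open>A row of a matrix. Its maps may have different codomains, so it is not a
  \<open>perp_family\<close>; it yields one after composing into a common codomain or after taking
  restrictions.\<close>

definition prow :: "'a \<Rightarrow> 'a list \<Rightarrow> (nat \<Rightarrow> 'b) \<Rightarrow> bool" where
  "prow A Bs f \<longleftrightarrow> A \<in> obj C \<and> set Bs \<subseteq> obj C \<and> (\<forall>j<length Bs. f j \<in> maps C A (Bs ! j)) \<and>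
    (\<forall>j<length Bs. \<forall>j'<length Bs. j \<noteq> j' \<longrightarrow> f j \<perp> f j')"

lemma prow_maps: "prow A Bs f \<Longrightarrow> j < length Bs \<Longrightarrow> f j \<in> maps C A (Bs ! j)"
  by (simp add: prow_def)

lemma prow_perp:
  "prow A Bs f \<Longrightarrow> j < length Bs \<Longrightarrow> j' < length Bs \<Longrightarrow> j \<noteq> j' \<Longrightarrow> f j \<perp> f j'"
  by (simp add: prow_def)

lemma prow_family_cmp:
  assumes "prow A Bs f" "D \<in> obj C" "\<And>j. j < length Bs \<Longrightarrow> g j \<in> maps C (Bs ! j) D"
  shows "perp_family C perp A D (length Bs) (\<lambda>j. f j \<cdot> g j)"
  unfolding perp_family_def
proof (intro conjI allI impI)
  show "A \<in> obj C" using assms(1) by (simp add: prow_def)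
  show "f j \<cdot> g j \<in> maps C A D" if "j < length Bs" for j
    using cmp_maps[OF prow_maps[OF assms(1) that] assms(3)[OF that]] .
  show "f j \<cdot> g j \<perp> f j' \<cdot> g j'" if "j < length Bs" "j' < length Bs" "j \<noteq> j'" for j j'
    using perp_cmp_right[OF prow_perp[OF assms(1) that] prow_maps[OF assms(1) that(1)]
        prow_maps[OF assms(1) that(2)] assms(3)[OF that(1)] assms(3)[OF that(2)]] .
qed (rule assms(2))

lemma prow_family_rst:
  assumes "prow A Bs f"
  shows "perp_family C perp A A (length Bs) (\<lambda>j. rst C (f j))"
  unfolding perp_family_def
proof (intro conjI allI impI)
  show "A \<in> obj C" "A \<in> obj C" using assms by (simp_all add: prow_def)
qed (use perp_rst[OF prow_perp[OF assms]] rst_maps[OF prow_maps[OF assms]] in blast)+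

lemma prow_cmp_left:
  assumes "prow A Bs f" "h \<in> maps C D A"
  shows "prow D Bs (\<lambda>j. h \<cdot> f j)"
  unfolding prow_def
proof (intro conjI allI impI)
  show "D \<in> obj C" by (rule maps_src_obj[OF assms(2)])
  show "set Bs \<subseteq> obj C" using assms(1) by (simp add: prow_def)
  show "h \<cdot> f j \<in> maps C D (Bs ! j)" if "j < length Bs" for j
    by (rule cmp_maps[OF assms(2) prow_maps[OF assms(1) that]])
  show "h \<cdot> f j \<perp> h \<cdot> f j'" if "j < length Bs" "j' < length Bs" "j \<noteq> j'" for j j'
    by (rule perp_cmp_left[OF prow_perp[OF assms(1) that] prow_maps[OF assms(1) that(1)]
        prow_maps[OF assms(1) that(2)] assms(2)])
qed

lemma prow_cmp_right:
  assumes "prow A Bs f" "\<And>j. j < length Bs \<Longrightarrow> g j \<in> maps C (Bs ! j) (Bs ! j)"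
  shows "prow A Bs (\<lambda>j. f j \<cdot> g j)"
  unfolding prow_def
proof (intro conjI allI impI)
  show "A \<in> obj C" "set Bs \<subseteq> obj C" using assms by (simp_all add: prow_def)
  show "f j \<cdot> g j \<in> maps C A (Bs ! j)" if "j < length Bs" for j
    using cmp_maps[OF prow_maps[OF assms(1) that] assms(2)[OF that]] .
  show "f j \<cdot> g j \<perp> f j' \<cdot> g j'" if "j < length Bs" "j' < length Bs" "j \<noteq> j'" for j j'
    using perp_cmp_right[OF prow_perp[OF assms(1) that] prow_maps[OF assms(1) that(1)]
        prow_maps[OF assms(1) that(2)] assms(2)[OF that(1)] assms(2)[OF that(2)]] .
qed

text \<open>The domain of definition of a whole row; these are the diagonal entries of the
  restriction of a matrix.\<close>

definition rrst :: "'a \<Rightarrow> 'a list \<Rightarrow> (nat \<Rightarrow> 'b) \<Rightarrow> 'b" where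
  "rrst A Bs f = djoin C A A (length Bs) (\<lambda>j. rst C (f j))"

lemma rrst_is_join:
  "prow A Bs f \<Longrightarrow> is_join C A A (length Bs) (\<lambda>j. rst C (f j)) (rrst A Bs f)"
  unfolding rrst_def by (rule djoin_is_join[OF prow_family_rst])

text \<open>Each \<open>rst C (f j)\<close> lies below the identity, hence so does their join, and
  everything below the identity is a restriction idempotent.\<close>

lemma ridem_rrst:
  assumes "prow A Bs f" shows "ridem A (rrst A Bs f)"
proof -
  have A: "A \<in> obj C" using assms by (simp add: prow_def)
  have "rle C (rrst A Bs f) (ide C A)"
    by (rule is_join_least[OF rrst_is_join[OF assms] ide_maps[OF A]])
      (use ridem_rle_ide ridem_rst prow_maps[OF assms] in blast)
  then show ?thesis using rle_ide_ridem A by blast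
qed

lemma rrst_cmp:
  assumes "prow A Bs f" "j < length Bs" shows "rrst A Bs f \<cdot> f j = f j"
proof -
  let ?r = "rrst A Bs f"
  have f: "f j \<in> maps C A (Bs ! j)" using prow_maps[OF assms] .
  have r: "ridem A ?r" using ridem_rrst[OF assms(1)] .
  have "rle C (rst C (f j)) ?r" using is_join_upper[OF rrst_is_join[OF assms(1)] assms(2)] .
  then have "rst C (f j) \<cdot> ?r = rst C (f j)"
    using rle_iff[OF rst_maps[OF f] ridem_maps[OF r]] rst_idem[OF f] by simp
  then have "?r \<cdot> rst C (f j) = rst C (f j)" using ridem_commute[OF r ridem_rst[OF f]] by simp
  then show ?thesis using cmp_assoc[OF ridem_maps[OF r] rst_maps[OF f] f] rst_cmp[OF f] by simp
qed

lemma rrst_cong: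
  assumes "\<And>j. j < length Bs \<Longrightarrow> f j = g j" "prow A Bs g"
  shows "rrst A Bs f = rrst A Bs g"
  unfolding rrst_def[of A Bs f]
  by (rule djoin_eq, subst is_join_cong[of _ _ "\<lambda>j. rst C (g j)"])
    (simp_all add: assms rrst_is_join)

text \<open>The idempotent comes out of each restriction by \<open>rst_ridem_cmp\<close> and out of
  the join by distributivity.\<close>

lemma rrst_cmp_ridem:
  assumes "prow A Bs f" "ridem A e"
  shows "rrst A Bs (\<lambda>j. e \<cdot> f j) = e \<cdot> rrst A Bs f"
proof -
  have "is_join C A A (length Bs) (\<lambda>j. e \<cdot> rst C (f j)) (e \<cdot> rrst A Bs f)"
    by (rule is_join_cmp_left[OF prow_family_rst rrst_is_join ridem_maps]) (use assms in blast)+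
  then have "is_join C A A (length Bs) (\<lambda>j. rst C (e \<cdot> f j)) (e \<cdot> rrst A Bs f)"
    using is_join_cong[of "length Bs" "\<lambda>j. rst C (e \<cdot> f j)" "\<lambda>j. e \<cdot> rst C (f j)"]
      rst_ridem_cmp[OF assms(2) prow_maps[OF assms(1)]] by simp
  then show ?thesis unfolding rrst_def by (rule djoin_eq)
qed

section \<open>Matrices and their composition\<close>

lemma mat_maps_iff:
  "F \<in> maps M As Bs \<longleftrightarrow> msrc F = As \<and> mtgt F = Bs \<and>
    ment F \<in> carrier_mat (length As) (length Bs) \<and> set As \<subseteq> obj C \<and> set Bs \<subseteq> obj C \<and>
    (\<forall>i<length As. prow (As ! i) Bs (\<lambda>j. entry F i j))"
  by (auto simp: maps_def mmap_arr_def prow_def subset_iff)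

lemma mat_maps_prow:
  "F \<in> maps M As Bs \<Longrightarrow> i < length As \<Longrightarrow> prow (As ! i) Bs (\<lambda>j. entry F i j)"
  by (simp add: mat_maps_iff)

lemma mat_maps_sel:
  assumes "F \<in> maps M As Bs"
  shows "msrc F = As" "mtgt F = Bs" "set As \<subseteq> obj C" "set Bs \<subseteq> obj C"
  using assms by (simp_all add: mat_maps_iff)

lemma mat_entry_maps:
  "F \<in> maps M As Bs \<Longrightarrow> i < length As \<Longrightarrow> j < length Bs \<Longrightarrow>
    entry F i j \<in> maps C (As ! i) (Bs ! j)"
  using prow_maps[OF mat_maps_prow] .

lemma mat_src_obj: "F \<in> maps M As Bs \<Longrightarrow> i < length As \<Longrightarrow> As ! i \<in> obj C"
  using subsetD[OF mat_maps_sel(3) nth_mem] .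

lemma mat_tgt_obj: "F \<in> maps M As Bs \<Longrightarrow> j < length Bs \<Longrightarrow> Bs ! j \<in> obj C"
  using subsetD[OF mat_maps_sel(4) nth_mem] .

lemma mat_mapsI:
  "set As \<subseteq> obj C \<Longrightarrow> set Bs \<subseteq> obj C \<Longrightarrow> (\<And>i. i < length As \<Longrightarrow> prow (As ! i) Bs (f i)) \<Longrightarrow>
    mk_mmap As Bs f \<in> maps M As Bs"
  unfolding mat_maps_iff by (simp add: prow_def)

lemma mat_eqI:
  assumes "F \<in> maps M As Bs" "G \<in> maps M As Bs"
    "\<And>i j. i < length As \<Longrightarrow> j < length Bs \<Longrightarrow> entry F i j = entry G i j"
  shows "F = G"
  using assms by (cases F; cases G) (auto simp: mat_maps_iff intro!: eq_matI)

text \<open>Zero is disjoint from everything, so a row that can be nonzero in only one place is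
  automatically disjoint. Diagonal matrices, zero matrices and injections have such rows.\<close>

lemma prow_single:
  assumes "A \<in> obj C" "set Bs \<subseteq> obj C" "\<And>j. j < length Bs \<Longrightarrow> f j \<in> maps C A (Bs ! j)"
    "\<And>j. j < length Bs \<Longrightarrow> j \<noteq> p \<Longrightarrow> f j = zer C A (Bs ! j)"
  shows "prow A Bs f"
  unfolding prow_def
proof (intro conjI allI impI)
  fix j j' assume j: "j < length Bs" "j' < length Bs" "j \<noteq> j'"
  have B: "Bs ! j \<in> obj C" "Bs ! j' \<in> obj C" using assms(2) j nth_mem by blast+
  show "f j \<perp> f j'"
  proof (cases "j = p")
    case True
    then have "f j' = zer C A (Bs ! j')" using assms(4)[OF j(2)] j(3) by simp
    then show ?thesis using perp_zer(1)[OF assms(3)[OF j(1)] B(2)] by simp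
  next
    case False
    then have "f j = zer C A (Bs ! j)" using assms(4)[OF j(1)] by simp
    then show ?thesis using perp_zer(2)[OF assms(3)[OF j(2)] B(1)] by simp
  qed
qed (rule assms; assumption?)+

lemma diag_mat_maps:
  assumes "set As \<subseteq> obj C" "\<And>i. i < length As \<Longrightarrow> e i \<in> maps C (As ! i) (As ! i)"
  shows "diag_mmap C As e \<in> maps M As As"
  unfolding diag_mmap_def
proof (rule mat_mapsI[OF assms(1,1)])
  fix i assume i: "i < length As"
  have A: "As ! l \<in> obj C" if "l < length As" for l using that assms(1) nth_mem by blast
  show "prow (As ! i) As (\<lambda>j. if i = j then e i else zer C (As ! i) (As ! j))"
    by (rule prow_single[where p = i, OF A[OF i] assms(1)])
      (auto intro: assms(2)[OF i] zer_maps[OF A[OF i] A])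
qed

lemma mat_cmp_family:
  assumes "F \<in> maps M As Bs" "G \<in> maps M Bs Ds"
    "i < length As" "k < length Ds"
  shows "perp_family C perp (As ! i) (Ds ! k) (length Bs) (\<lambda>j. entry F i j \<cdot> entry G j k)"
  using prow_family_cmp[OF mat_maps_prow[OF assms(1,3)] mat_tgt_obj[OF assms(2,4)]
      mat_entry_maps[OF assms(2) _ assms(4)]] .

lemma entry_cmp_is_join:
  assumes "F \<in> maps M As Bs" "G \<in> maps M Bs Ds"
    "i < length As" "k < length Ds"
  shows "is_join C (As ! i) (Ds ! k) (length Bs) (\<lambda>j. entry F i j \<cdot> entry G j k)
    (entry (mmap_cmp C F G) i k)"
  using djoin_is_join[OF mat_cmp_family[OF assms]] mat_maps_sel[OF assms(1)] mat_maps_sel[OF assms(2)]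
    assms(3,4) by (simp add: mmap_cmp_def)

text \<open>Two terms with the same middle index share the entry of \<open>F\<close>, and
  \<open>G\<close>, \<open>H\<close> are disjoint there; with different middle indices the row of
  \<open>F\<close> separates them. Taking \<open>H = G\<close> and two different columns gives
  closure of matrices under composition.\<close>

lemma mat_cmp_perp:
  assumes "F \<in> maps M As Bs" "G \<in> maps M Bs Ds"
    "H \<in> maps M Bs Es"
    "i < length As" "k < length Ds" "l < length Es"
    and perp: "\<And>j. j < length Bs \<Longrightarrow> entry G j k \<perp> entry H j l"
  shows "entry (mmap_cmp C F G) i k \<perp> entry (mmap_cmp C F H) i l"
proof (rule is_join_perp_is_join[OF mat_cmp_family[OF assms(1,2,4,5)]
      entry_cmp_is_join[OF assms(1,2,4,5)] mat_cmp_family[OF assms(1,3,4,6)]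
      entry_cmp_is_join[OF assms(1,3,4,6)]])
  fix j j' assume j: "j < length Bs" "j' < length Bs"
  note F = mat_entry_maps[OF assms(1,4)]
  note G = mat_entry_maps[OF assms(2) _ assms(5)] and H = mat_entry_maps[OF assms(3) _ assms(6)]
  show "entry F i j \<cdot> entry G j k \<perp> entry F i j' \<cdot> entry H j' l"
  proof (cases "j = j'")
    case True
    then show ?thesis using perp_cmp_left[OF perp G H F] j by blast
  next
    case False
    then have "entry F i j \<perp> entry F i j'"
      using mat_maps_prow[OF assms(1,4)] j by (simp add: prow_def)
    then show ?thesis using perp_cmp_right[OF _ F F G H] j by blast
  qed
qed

lemma mat_cmp_maps:
  assumes "F \<in> maps M As Bs" "G \<in> maps M Bs Ds"
  shows "mmap_cmp C F G \<in> maps M As Ds"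
proof -
  have "prow (As ! i) Ds (\<lambda>k. entry (mmap_cmp C F G) i k)" if i: "i < length As" for i
    unfolding prow_def
  proof (intro conjI allI impI)
    show "As ! i \<in> obj C" by (rule mat_src_obj[OF assms(1) i])
    show "set Ds \<subseteq> obj C" by (rule mat_maps_sel[OF assms(2)])
    show "entry (mmap_cmp C F G) i k \<in> maps C (As ! i) (Ds ! k)" if "k < length Ds" for k
      using is_join_maps[OF entry_cmp_is_join[OF assms i that]] .
    show "entry (mmap_cmp C F G) i k \<perp> entry (mmap_cmp C F G) i k'"
      if k: "k < length Ds" "k' < length Ds" "k \<noteq> k'" for k k'
      by (rule mat_cmp_perp[OF assms(1,2,2) i k(1,2)])
        (use mat_maps_prow[OF assms(2)] k in \<open>simp add: prow_def\<close>)
  qed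
  then show ?thesis
    using mat_maps_sel[OF assms(1)] mat_maps_sel[OF assms(2)]
    \<comment> \<open>\<open>mmap_cmp_def\<close> is held back so that the entries of the product
      stay in the folded form in which the row property was proved.\<close>
    by (simp add: mat_maps_iff) (simp add: mmap_cmp_def)
qed

lemma entry_diag_cmp:
  assumes "F \<in> maps M As Bs" "\<And>i. i < length As \<Longrightarrow> e i \<in> maps C (As ! i) (As ! i)"
    "i < length As" "j < length Bs"
  shows "entry (mmap_cmp C (diag_mmap C As e) F) i j = e i \<cdot> entry F i j"
proof -
  have D: "diag_mmap C As e \<in> maps M As As"
    by (rule diag_mat_maps[OF mat_maps_sel(3)[OF assms(1)] assms(2)])
  have A: "As ! i \<in> obj C" using mat_src_obj[OF assms(1,3)] .
  have "is_join C (As ! i) (Bs ! j) (length As)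
      (\<lambda>l. entry (diag_mmap C As e) i l \<cdot> entry F l j) (e i \<cdot> entry F i j)"
    by (rule is_join_single[OF assms(3) _ cmp_maps[OF assms(2)[OF assms(3)] mat_entry_maps[OF assms(1,3,4)]]])
      (simp_all add: assms(3,4) zer_cmp[OF mat_entry_maps[OF assms(1)] A])
  then show ?thesis
    using is_join_unique[OF entry_cmp_is_join[OF D assms(1,3,4)]] assms(3) by simp
qed

lemma entry_cmp_diag:
  assumes "F \<in> maps M As Bs" "\<And>j. j < length Bs \<Longrightarrow> e j \<in> maps C (Bs ! j) (Bs ! j)"
    "i < length As" "j < length Bs"
  shows "entry (mmap_cmp C F (diag_mmap C Bs e)) i j = entry F i j \<cdot> e j"
proof -
  have D: "diag_mmap C Bs e \<in> maps M Bs Bs"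
    by (rule diag_mat_maps[OF mat_maps_sel(4)[OF assms(1)] assms(2)])
  have B: "Bs ! j \<in> obj C" using mat_tgt_obj[OF assms(1,4)] .
  have "is_join C (As ! i) (Bs ! j) (length Bs)
      (\<lambda>l. entry F i l \<cdot> entry (diag_mmap C Bs e) l j) (entry F i j \<cdot> e j)"
    by (rule is_join_single[OF assms(4) _ cmp_maps[OF mat_entry_maps[OF assms(1,3,4)] assms(2)[OF assms(4)]]])
      (simp_all add: assms(3,4) cmp_zer[OF mat_entry_maps[OF assms(1)] B])
  then show ?thesis
    using is_join_unique[OF entry_cmp_is_join[OF assms(1) D assms(3,4)]] assms(4) by simp
qed

text \<open>An entry of either side is the join of the double family of triple products. On the left
  the inner join is treated by postcomposition, on the right by precomposition, and
  \<open>is_join_swap\<close> compares the two orders.\<close>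

lemma mat_cmp_assoc:
  assumes "F \<in> maps M As Bs" "G \<in> maps M Bs Ds"
    "H \<in> maps M Ds Es"
  shows "mmap_cmp C (mmap_cmp C F G) H = mmap_cmp C F (mmap_cmp C G H)"
proof (rule mat_eqI)
  have FG: "mmap_cmp C F G \<in> maps M As Ds" and GH: "mmap_cmp C G H \<in> maps M Bs Es"
    using assms mat_cmp_maps by blast+
  show "mmap_cmp C (mmap_cmp C F G) H \<in> maps M As Es"
    "mmap_cmp C F (mmap_cmp C G H) \<in> maps M As Es"
    using FG GH assms mat_cmp_maps by blast+
  fix i l assume i: "i < length As" and l: "l < length Es"
  have "is_join C (As ! i) (Es ! l) (length Bs) (\<lambda>j. entry F i j \<cdot> entry (mmap_cmp C G H) j l)
      (entry (mmap_cmp C (mmap_cmp C F G) H) i l)"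
  proof (rule is_join_swap)
    show "is_join C (As ! i) (Es ! l) (length Ds) (\<lambda>k. entry (mmap_cmp C F G) i k \<cdot> entry H k l)
       (entry (mmap_cmp C (mmap_cmp C F G) H) i l)"
      by (rule entry_cmp_is_join[OF FG assms(3) i l])
    show "is_join C (As ! i) (Es ! l) (length Bs) (\<lambda>j. entry F i j \<cdot> entry G j k \<cdot> entry H k l)
       (entry (mmap_cmp C F G) i k \<cdot> entry H k l)" if k: "k < length Ds" for k
      by (rule is_join_cmp_right[OF mat_cmp_family[OF assms(1,2) i k]
            entry_cmp_is_join[OF assms(1,2) i k] mat_entry_maps[OF assms(3) k l]])
    show "is_join C (As ! i) (Es ! l) (length Ds) (\<lambda>k. entry F i j \<cdot> entry G j k \<cdot> entry H k l)
       (entry F i j \<cdot> entry (mmap_cmp C G H) j l)" if j: "j < length Bs" for j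
      using is_join_cmp_left[OF mat_cmp_family[OF assms(2,3) j l]
            entry_cmp_is_join[OF assms(2,3) j l] mat_entry_maps[OF assms(1) i j]]
        cmp_assoc[OF mat_entry_maps[OF assms(1) i j] mat_entry_maps[OF assms(2) j]
          mat_entry_maps[OF assms(3) _ l]]
      by (subst is_join_cong) auto
  qed
  then show "entry (mmap_cmp C (mmap_cmp C F G) H) i l = entry (mmap_cmp C F (mmap_cmp C G H)) i l"
    using is_join_unique[OF entry_cmp_is_join[OF assms(1) GH i l]] by simp
qed

lemma mat_category: "category M"
proof (unfold_locales, goal_cases)
  case (1 f) then show ?case by (auto simp: mmap_arr_def)
next
  case (2 f) then show ?case by (auto simp: mmap_arr_def)
next
  case (3 As)
  then show ?case using diag_mat_maps[of As "\<lambda>i. ide C (As ! i)"] ide_maps by (auto simp: subset_iff)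
next
  case 4 then show ?case using mat_cmp_maps[OF 4] by simp
next
  case (5 F As Bs)
  have I: "ide C (As ! i) \<in> maps C (As ! i) (As ! i)" if "i < length As" for i
    using ide_maps mat_src_obj[OF 5 that] .
  have "mmap_cmp C (diag_mmap C As (\<lambda>i. ide C (As ! i))) F = F"
    by (rule mat_eqI[OF mat_cmp_maps[OF diag_mat_maps[OF mat_maps_sel(3)[OF 5] I] 5] 5])
      (simp_all add: entry_diag_cmp[OF 5 I] ide_left[OF mat_entry_maps[OF 5]])
  then show ?case by simp
next
  case (6 F As Bs)
  have I: "ide C (Bs ! i) \<in> maps C (Bs ! i) (Bs ! i)" if "i < length Bs" for i
    using ide_maps mat_tgt_obj[OF 6 that] .
  have "mmap_cmp C F (diag_mmap C Bs (\<lambda>i. ide C (Bs ! i))) = F"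
    by (rule mat_eqI[OF mat_cmp_maps[OF 6 diag_mat_maps[OF mat_maps_sel(4)[OF 6] I]] 6])
      (simp_all add: entry_cmp_diag[OF 6 I] ide_right[OF mat_entry_maps[OF 6]])
  then show ?case by simp
next
  case (7 F As Bs G Ds H Es)
  then show ?case using mat_cmp_assoc[OF 7] by simp
qed

section \<open>Restriction of matrices\<close>

lemma mat_rst_eq:
  "F \<in> maps M As Bs \<Longrightarrow>
    mmap_rst C F = diag_mmap C As (\<lambda>i. rrst (As ! i) Bs (\<lambda>j. entry F i j))"
  by (simp add: mat_maps_iff mmap_rst_def rrst_def)

lemma mat_ridem_rrst:
  "F \<in> maps M As Bs \<Longrightarrow> i < length As \<Longrightarrow>
    ridem (As ! i) (rrst (As ! i) Bs (\<lambda>j. entry F i j))"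
  using ridem_rrst[OF mat_maps_prow] .

lemma mat_rst_maps:
  assumes "F \<in> maps M As Bs" shows "mmap_rst C F \<in> maps M As As"
  unfolding mat_rst_eq[OF assms]
  by (rule diag_mat_maps[OF mat_maps_sel(3)[OF assms] ridem_maps[OF mat_ridem_rrst[OF assms]]])

lemma entry_rst_cmp:
  assumes "F \<in> maps M As Bs" "G \<in> maps M As Ds" "i < length As" "j < length Ds"
  shows "entry (mmap_cmp C (mmap_rst C F) G) i j = rrst (As ! i) Bs (\<lambda>j. entry F i j) \<cdot> entry G i j"
  unfolding mat_rst_eq[OF assms(1)]
  by (rule entry_diag_cmp[OF assms(2) ridem_maps[OF mat_ridem_rrst[OF assms(1)]] assms(3,4)])

text \<open>The restriction \<open>?r\<close> of row \<open>i\<close> of the product is the join of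
  the \<open>e j'\<close>, where \<open>e j'\<close> is the domain on which the row passes through
  column \<open>j'\<close> and continues along \<open>G\<close>. Multiplied by
  \<open>entry F i j\<close> only the term \<open>e j\<close> survives, and for it the claim is
  \<open>cmp_rst\<close> in the base category.\<close>

lemma mat_cmp_rst:
  assumes "F \<in> maps M As Bs" "G \<in> maps M Bs Ds"
  shows "mmap_cmp C F (mmap_rst C G) = mmap_cmp C (mmap_rst C (mmap_cmp C F G)) F"
proof (rule mat_eqI)
  have FG: "mmap_cmp C F G \<in> maps M As Ds" using assms by (rule mat_cmp_maps)
  show "mmap_cmp C F (mmap_rst C G) \<in> maps M As Bs"
    using mat_cmp_maps[OF assms(1) mat_rst_maps[OF assms(2)]] .
  show "mmap_cmp C (mmap_rst C (mmap_cmp C F G)) F \<in> maps M As Bs"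
    using mat_cmp_maps[OF mat_rst_maps[OF FG] assms(1)] .
  fix i j assume i: "i < length As" and j: "j < length Bs"
  let ?A = "As ! i"
  have A: "?A \<in> obj C" using mat_src_obj[OF assms(1) i] .
  define g where "g j = rrst (Bs ! j) Ds (\<lambda>k. entry G j k)" for j
  define e where "e j = rst C (entry F i j \<cdot> g j)" for j
  note F = mat_entry_maps[OF assms(1) i] and G = mat_entry_maps[OF assms(2)]
  have g: "ridem (Bs ! j) (g j)" if "j < length Bs" for j
    unfolding g_def by (rule mat_ridem_rrst[OF assms(2) that])
  have e: "ridem ?A (e j)" if "j < length Bs" for j
    unfolding e_def using ridem_rst[OF cmp_maps[OF F ridem_maps[OF g]]] that by blast
  \<comment> \<open>This factor is what meets \<open>entry F i j'\<close> for another column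
    \<open>j'\<close> below, where the disjointness of the row of \<open>F\<close> gives
    zero.\<close>
  have e_le: "e j = e j \<cdot> rst C (entry F i j)" if "j < length Bs" for j
    unfolding e_def using rst_cmp_le(1)[OF F ridem_maps[OF g], symmetric] that by blast
  have ej: "is_join C ?A ?A (length Ds) (\<lambda>k. rst C (entry F i j \<cdot> entry G j k)) (e j)"
    if j: "j < length Bs" for j
  proof -
    note fam = prow_family_rst[OF mat_maps_prow[OF assms(2) j]]
    have "is_join C ?A ?A (length Ds) (\<lambda>k. rst C (entry F i j \<cdot> rst C (entry G j k))) (e j)"
      unfolding e_def g_def
      by (rule is_join_rst[OF perp_family_cmp_left[OF fam F[OF j]]
            is_join_cmp_left[OF fam rrst_is_join[OF mat_maps_prow[OF assms(2) j]] F[OF j]]])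
    then show ?thesis by (subst (asm) is_join_cong) (use rst_cmp_rst[OF F[OF j] G[OF j]] in auto)
  qed
  let ?r = "rrst ?A Ds (\<lambda>k. entry (mmap_cmp C F G) i k)"
  \<comment> \<open>\<open>?r\<close> joins over \<open>k\<close> the restrictions of the entries of
    the product, each itself a join over the middle index; joining over \<open>k\<close> first gives
    the \<open>e j\<close> instead.\<close>
  have r: "is_join C ?A ?A (length Bs) e ?r"
    by (rule is_join_swap[OF _ rrst_is_join[OF mat_maps_prow[OF FG i]] ej])
      (use is_join_rst[OF mat_cmp_family[OF assms i] entry_cmp_is_join[OF assms i]] in auto)
  have pe: "perp_family C perp ?A ?A (length Bs) e"
    unfolding e_def
    by (rule prow_family_rst[OF prow_cmp_right[OF mat_maps_prow[OF assms(1) i] ridem_maps[OF g]]])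
  have "is_join C ?A (Bs ! j) (length Bs) (\<lambda>j'. e j' \<cdot> entry F i j) (?r \<cdot> entry F i j)"
    by (rule is_join_cmp_right[OF pe r F[OF j]])
  moreover have "is_join C ?A (Bs ! j) (length Bs) (\<lambda>j'. e j' \<cdot> entry F i j) (e j \<cdot> entry F i j)"
  proof (rule is_join_single[OF j _ cmp_maps[OF ridem_maps[OF e[OF j]] F[OF j]]])
    show "e j \<cdot> entry F i j = e j \<cdot> entry F i j" ..
    fix j' assume j': "j' < length Bs" "j' \<noteq> j"
    have p: "entry F i j' \<perp> entry F i j"
      using mat_maps_prow[OF assms(1) i] j j' by (simp add: prow_def)
    have "e j' \<cdot> entry F i j = e j' \<cdot> (rst C (entry F i j') \<cdot> entry F i j)"
      using e_le[OF j'(1)] cmp_assoc[OF ridem_maps[OF e[OF j'(1)]] rst_maps[OF F[OF j'(1)]] F[OF j]]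
      by simp
    then show "e j' \<cdot> entry F i j = zer C ?A (Bs ! j)"
      using perp_rst_cmp_zer[OF p F[OF j'(1)] F[OF j]] cmp_zer[OF ridem_maps[OF e[OF j'(1)]]]
        maps_tgt_obj[OF F[OF j]] by simp
  qed
  ultimately have "?r \<cdot> entry F i j = e j \<cdot> entry F i j" by (rule is_join_unique)
  also have "\<dots> = entry F i j \<cdot> rst C (g j)"
    unfolding e_def using cmp_rst[OF F[OF j] ridem_maps[OF g[OF j]]] by simp
  also have "\<dots> = entry F i j \<cdot> g j" using g[OF j] by (simp add: ridem_def)
  also have "\<dots> = entry (mmap_cmp C F (mmap_rst C G)) i j"
    using mat_rst_eq[OF assms(2)] entry_cmp_diag[OF assms(1) ridem_maps[OF g] i j]
    by (simp add: g_def)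
  finally show "entry (mmap_cmp C F (mmap_rst C G)) i j =
      entry (mmap_cmp C (mmap_rst C (mmap_cmp C F G)) F) i j"
    using entry_rst_cmp[OF FG assms(1) i j] by simp
qed

lemma entry_rst:
  assumes "F \<in> maps M As Bs" "i < length As" "j < length As"
  shows "entry (mmap_rst C F) i j =
    (if i = j then rrst (As ! i) Bs (\<lambda>k. entry F i k) else zer C (As ! i) (As ! j))"
  using assms by (simp add: mat_rst_eq)

lemma entry_rst_cmp_rst:
  assumes "F \<in> maps M As Bs" "G \<in> maps M As Ds" "i < length As" "j < length As"
  shows "entry (mmap_cmp C (mmap_rst C F) (mmap_rst C G)) i j =
    (if i = j then rrst (As ! i) Bs (\<lambda>k. entry F i k) \<cdot> rrst (As ! i) Ds (\<lambda>k. entry G i k)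
     else zer C (As ! i) (As ! j))"
  using entry_rst_cmp[OF assms(1) mat_rst_maps[OF assms(2)] assms(3,4)] entry_rst[OF assms(2-4)]
    cmp_zer[OF ridem_maps[OF mat_ridem_rrst[OF assms(1,3)]] mat_src_obj[OF assms(1,4)]] by simp

lemma mat_restriction_category: "restriction_category M"
proof (rule restriction_category.intro[OF mat_category], unfold_locales, goal_cases)
  case (1 F As Bs) then show ?case using mat_rst_maps[OF 1] by simp
next
  case (2 F As Bs)
  have "mmap_cmp C (mmap_rst C F) F = F"
    by (rule mat_eqI[OF mat_cmp_maps[OF mat_rst_maps[OF 2] 2] 2])
      (simp add: entry_rst_cmp[OF 2 2] rrst_cmp[OF mat_maps_prow[OF 2]])
  then show ?case by simp
next
  case (3 F As Bs G Ds)
  have "mmap_cmp C (mmap_rst C F) (mmap_rst C G) = mmap_cmp C (mmap_rst C G) (mmap_rst C F)"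
    by (rule mat_eqI[OF mat_cmp_maps[OF mat_rst_maps[OF 3(1)] mat_rst_maps[OF 3(2)]]
          mat_cmp_maps[OF mat_rst_maps[OF 3(2)] mat_rst_maps[OF 3(1)]]])
      (use entry_rst_cmp_rst[OF 3(1,2)] entry_rst_cmp_rst[OF 3(2,1)]
        ridem_commute[OF mat_ridem_rrst[OF 3(1)] mat_ridem_rrst[OF 3(2)]] in simp)
  then show ?case by simp
next
  \<comment> \<open>Row \<open>i\<close> of the composite is the row of \<open>F\<close> cut down by
    an idempotent, which \<open>rrst_cmp_ridem\<close> moves out of the row restriction.\<close>
  case (4 F As Bs G Ds)
  have GF: "mmap_cmp C (mmap_rst C G) F \<in> maps M As Bs"
    by (rule mat_cmp_maps[OF mat_rst_maps[OF 4(2)] 4(1)])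
  have "mmap_rst C (mmap_cmp C (mmap_rst C G) F) = mmap_cmp C (mmap_rst C G) (mmap_rst C F)"
  proof (rule mat_eqI[OF mat_rst_maps[OF GF] mat_cmp_maps[OF mat_rst_maps[OF 4(2)] mat_rst_maps[OF 4(1)]]])
    fix i j assume i: "i < length As" and j: "j < length As"
    let ?g = "rrst (As ! i) Ds (\<lambda>k. entry G i k)"
    have "rrst (As ! i) Bs (\<lambda>k. entry (mmap_cmp C (mmap_rst C G) F) i k) =
        rrst (As ! i) Bs (\<lambda>k. ?g \<cdot> entry F i k)"
      by (rule rrst_cong)
        (use entry_rst_cmp[OF 4(2,1) i] prow_cmp_left[OF mat_maps_prow[OF 4(1) i]
          ridem_maps[OF mat_ridem_rrst[OF 4(2) i]]] in auto)
    also have "\<dots> = ?g \<cdot> rrst (As ! i) Bs (\<lambda>k. entry F i k)"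
      by (rule rrst_cmp_ridem[OF mat_maps_prow[OF 4(1) i] mat_ridem_rrst[OF 4(2) i]])
    finally show "entry (mmap_rst C (mmap_cmp C (mmap_rst C G) F)) i j =
        entry (mmap_cmp C (mmap_rst C G) (mmap_rst C F)) i j"
      using entry_rst[OF GF i j] entry_rst_cmp_rst[OF 4(2,1) i j] by auto
  qed
  then show ?case by simp
next
  case 5 then show ?case using mat_cmp_rst[OF 5] by simp
qed

section \<open>Zero matrices and the order on matrices\<close>

lemma mat_zer_maps:
  assumes "set As \<subseteq> obj C" "set Bs \<subseteq> obj C"
  shows "mk_mmap As Bs (\<lambda>i j. zer C (As ! i) (Bs ! j)) \<in> maps M As Bs"
proof (rule mat_mapsI[OF assms])
  fix i assume "i < length As"
  then have A: "As ! i \<in> obj C" using assms(1) nth_mem by blast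
  show "prow (As ! i) Bs (\<lambda>j. zer C (As ! i) (Bs ! j))"
    by (rule prow_single[OF A assms(2)]) (use zer_maps[OF A] assms(2) nth_mem in blast, rule refl)
qed

lemma mat_restriction_category_zeroes: "restriction_category_zeroes M"
proof (rule restriction_category_zeroes.intro[OF mat_restriction_category], unfold_locales, goal_cases)
  case (1 As Bs) then show ?case using mat_zer_maps by simp
next
  case (2 F As Bs Ds)
  then have D: "set Ds \<subseteq> obj C" by simp
  note B = mat_maps_sel(4)[OF 2(1)] and A = mat_maps_sel(3)[OF 2(1)]
  note Z = mat_zer_maps[OF B D]
  have "mmap_cmp C F (mk_mmap Bs Ds (\<lambda>i j. zer C (Bs ! i) (Ds ! j))) =
      mk_mmap As Ds (\<lambda>i j. zer C (As ! i) (Ds ! j))"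
  proof (rule mat_eqI[OF mat_cmp_maps[OF 2(1) Z] mat_zer_maps[OF A D]])
    fix i j assume i: "i < length As" and j: "j < length Ds"
    have d: "Ds ! j \<in> obj C" using D j nth_mem by blast
    have "is_join C (As ! i) (Ds ! j) (length Bs)
        (\<lambda>l. entry F i l \<cdot> entry (mk_mmap Bs Ds (\<lambda>i j. zer C (Bs ! i) (Ds ! j))) l j)
        (zer C (As ! i) (Ds ! j))"
      by (rule is_join_zer[OF mat_src_obj[OF 2(1) i] d])
        (simp add: j cmp_zer[OF mat_entry_maps[OF 2(1) i] d])
    then show "entry (mmap_cmp C F (mk_mmap Bs Ds (\<lambda>i j. zer C (Bs ! i) (Ds ! j)))) i j =
        entry (mk_mmap As Ds (\<lambda>i j. zer C (As ! i) (Ds ! j))) i j"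
      using is_join_unique[OF entry_cmp_is_join[OF 2(1) Z i j]] i j by simp
  qed
  then show ?case by simp
next
  case (3 F As Bs Ds)
  then have D: "set Ds \<subseteq> obj C" by simp
  note B = mat_maps_sel(4)[OF 3(1)] and A = mat_maps_sel(3)[OF 3(1)]
  note Z = mat_zer_maps[OF D A]
  have "mmap_cmp C (mk_mmap Ds As (\<lambda>i j. zer C (Ds ! i) (As ! j))) F =
      mk_mmap Ds Bs (\<lambda>i j. zer C (Ds ! i) (Bs ! j))"
  proof (rule mat_eqI[OF mat_cmp_maps[OF Z 3(1)] mat_zer_maps[OF D B]])
    fix i j assume i: "i < length Ds" and j: "j < length Bs"
    have d: "Ds ! i \<in> obj C" using D i nth_mem by blast
    have "is_join C (Ds ! i) (Bs ! j) (length As)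
        (\<lambda>l. entry (mk_mmap Ds As (\<lambda>i j. zer C (Ds ! i) (As ! j))) i l \<cdot> entry F l j)
        (zer C (Ds ! i) (Bs ! j))"
      by (rule is_join_zer[OF d mat_tgt_obj[OF 3(1) j]])
        (simp add: i zer_cmp[OF mat_entry_maps[OF 3(1) _ j] d])
    then show "entry (mmap_cmp C (mk_mmap Ds As (\<lambda>i j. zer C (Ds ! i) (As ! j))) F) i j =
        entry (mk_mmap Ds Bs (\<lambda>i j. zer C (Ds ! i) (Bs ! j))) i j"
      using is_join_unique[OF entry_cmp_is_join[OF Z 3(1) i j]] i j by simp
  qed
  then show ?case by simp
next
  case (4 As Bs)
  then have A: "set As \<subseteq> obj C" and B: "set Bs \<subseteq> obj C" by simp_all
  note Z = mat_zer_maps[OF A B]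
  have "mmap_rst C (mk_mmap As Bs (\<lambda>i j. zer C (As ! i) (Bs ! j))) =
      mk_mmap As As (\<lambda>i j. zer C (As ! i) (As ! j))"
  proof (rule mat_eqI[OF mat_rst_maps[OF Z] mat_zer_maps[OF A A]])
    fix i j assume i: "i < length As" and j: "j < length As"
    have a: "As ! i \<in> obj C" using A i nth_mem by blast
    have b: "Bs ! k \<in> obj C" if "k < length Bs" for k using B that nth_mem by blast
    have "is_join C (As ! i) (As ! i) (length Bs)
        (\<lambda>k. rst C (entry (mk_mmap As Bs (\<lambda>i j. zer C (As ! i) (Bs ! j))) i k))
        (zer C (As ! i) (As ! i))"
      by (rule is_join_zer[OF a a]) (simp add: i rst_zer[OF a b])
    then have "rrst (As ! i) Bs (\<lambda>k. entry (mk_mmap As Bs (\<lambda>i j. zer C (As ! i) (Bs ! j))) i k) =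
        zer C (As ! i) (As ! i)"
      using is_join_unique[OF rrst_is_join[OF mat_maps_prow[OF Z i]]] by simp
    then show "entry (mmap_rst C (mk_mmap As Bs (\<lambda>i j. zer C (As ! i) (Bs ! j)))) i j =
        entry (mk_mmap As As (\<lambda>i j. zer C (As ! i) (As ! j))) i j"
      using entry_rst[OF Z i j] i j by auto
  qed
  then show ?case by simp
qed

text \<open>For \<open>l \<noteq> j\<close>, \<open>f l\<close> lies below \<open>g l\<close>, which
  is disjoint from \<open>g j\<close>; so that part of the row restriction annihilates
  \<open>g j\<close> and only \<open>rst C (f j) \<cdot> g j = f j\<close> remains.\<close>

lemma rrst_cmp_above:
  assumes "prow A Bs f" "prow A Bs g" "\<And>j. j < length Bs \<Longrightarrow> rle C (f j) (g j)" "j < length Bs"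
  shows "rrst A Bs f \<cdot> g j = f j"
proof -
  note f = prow_maps[OF assms(1)] and g = prow_maps[OF assms(2)]
  have "is_join C A (Bs ! j) (length Bs) (\<lambda>l. rst C (f l) \<cdot> g j) (rrst A Bs f \<cdot> g j)"
    by (rule is_join_cmp_right[OF prow_family_rst[OF assms(1)] rrst_is_join[OF assms(1)] g[OF assms(4)]])
  moreover have "is_join C A (Bs ! j) (length Bs) (\<lambda>l. rst C (f l) \<cdot> g j) (f j)"
  proof (rule is_join_single[OF assms(4) _ f[OF assms(4)]])
    show "rst C (f j) \<cdot> g j = f j"
      using assms(3)[OF assms(4)] rle_iff[OF f[OF assms(4)] g[OF assms(4)]] by simp
    fix l assume l: "l < length Bs" "l \<noteq> j"
    have "f l \<perp> g j"
      using perp_down[OF prow_perp[OF assms(2) l(1) assms(4) l(2)] assms(3)[OF l(1)]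
          rle_refl[OF g[OF assms(4)]]] .
    then show "rst C (f l) \<cdot> g j = zer C A (Bs ! j)"
      by (rule perp_rst_cmp_zer[OF _ f[OF l(1)] g[OF assms(4)]])
  qed
  ultimately show ?thesis by (rule is_join_unique)
qed

text \<open>The matrix order cuts \<open>G\<close> down by row idempotents, the entrywise order by
  the restriction of each entry separately; \<open>rrst_cmp_above\<close> shows that the larger
  idempotent has the same effect.\<close>

lemma mat_rle_iff:
  assumes "F \<in> maps M As Bs" "G \<in> maps M As Bs"
  shows "rle M F G \<longleftrightarrow> (\<forall>i<length As. \<forall>j<length Bs. rle C (entry F i j) (entry G i j))"
proof -
  have "rle M F G \<longleftrightarrow> mmap_cmp C (mmap_rst C F) G = F"
    using restriction_category.rle_iff[OF mat_restriction_category assms] by simp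
  also have "\<dots> \<longleftrightarrow> (\<forall>i<length As. \<forall>j<length Bs.
      rrst (As ! i) Bs (\<lambda>j. entry F i j) \<cdot> entry G i j = entry F i j)"
    using mat_eqI[OF mat_cmp_maps[OF mat_rst_maps[OF assms(1)] assms(2)] assms(1)]
      entry_rst_cmp[OF assms] by auto
  also have "\<dots> \<longleftrightarrow> (\<forall>i<length As. \<forall>j<length Bs. rle C (entry F i j) (entry G i j))"
  proof (intro iffI allI impI)
    fix i j assume *: "\<forall>i<length As. \<forall>j<length Bs.
      rrst (As ! i) Bs (\<lambda>j. entry F i j) \<cdot> entry G i j = entry F i j"
      and i: "i < length As" and j: "j < length Bs"
    then show "rle C (entry F i j) (entry G i j)"
      using ridem_cmp_rle[OF mat_ridem_rrst[OF assms(1) i] mat_entry_maps[OF assms(2) i j]] by simp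
  next
    fix i j assume *: "\<forall>i<length As. \<forall>j<length Bs. rle C (entry F i j) (entry G i j)"
      and i: "i < length As" and j: "j < length Bs"
    then show "rrst (As ! i) Bs (\<lambda>j. entry F i j) \<cdot> entry G i j = entry F i j"
      using rrst_cmp_above[OF mat_maps_prow[OF assms(1) i] mat_maps_prow[OF assms(2) i] _ j] by simp
  qed
  finally show ?thesis .
qed

end

section \<open>Coproducts\<close>

definition block_start :: "'a list list \<Rightarrow> nat \<Rightarrow> nat" where
  "block_start Ls j = length (concat (take j Ls))"

text \<open>The inverse of \<open>block_start Ls j + r\<close>. Empty blocks are skipped because the
  test \<open>p < length L\<close> fails for them; the clause for \<open>[]\<close> is reached only
  by positions outside \<open>concat Ls\<close>.\<close>

fun block_index :: "'a list list \<Rightarrow> nat \<Rightarrow> nat \<times> nat" where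
  "block_index [] p = (0, 0)"
| "block_index (L # Ls) p =
    (if p < length L then (0, p) else apfst Suc (block_index Ls (p - length L)))"

lemma block_start_simps [simp]:
  "block_start Ls 0 = 0"
  "block_start (L # Ls) (Suc j) = length L + block_start Ls j"
  by (simp_all add: block_start_def)

lemma block_index_start [simp]:
  "j < length Ls \<Longrightarrow> r < length (Ls ! j) \<Longrightarrow> block_index Ls (block_start Ls j + r) = (j, r)"
proof (induction Ls arbitrary: j)
  case (Cons L Ls)
  then show ?case by (cases j) auto
qed simp

lemma block_start_less [simp]:
  "j < length Ls \<Longrightarrow> r < length (Ls ! j) \<Longrightarrow> block_start Ls j + r < length (concat Ls)"
proof (induction Ls arbitrary: j)
  case (Cons L Ls)
  then show ?case by (cases j) auto
qed simp

lemma concat_nth_block [simp]: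
  "j < length Ls \<Longrightarrow> r < length (Ls ! j) \<Longrightarrow> concat Ls ! (block_start Ls j + r) = Ls ! j ! r"
proof (induction Ls arbitrary: j)
  case (Cons L Ls)
  then show ?case by (cases j) (auto simp: nth_append)
qed simp

lemma block_index_cases:
  assumes "p < length (concat Ls)"
  obtains j r where "j < length Ls" "r < length (Ls ! j)" "p = block_start Ls j + r"
proof -
  have "\<exists>j r. j < length Ls \<and> r < length (Ls ! j) \<and> p = block_start Ls j + r"
    using assms
  proof (induction Ls arbitrary: p)
    case (Cons L Ls)
    show ?case
    proof (cases "p < length L")
      case True
      then show ?thesis by (intro exI[of _ 0] exI[of _ p]) simp
    next
      case False
      then have "p - length L < length (concat Ls)" using Cons.prems by simp
      then obtain j r where "j < length Ls" "r < length (Ls ! j)" "p - length L = block_start Ls j + r"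
        using Cons.IH by blast
      then show ?thesis using False by (intro exI[of _ "Suc j"] exI[of _ r]) simp
    qed
  qed simp
  then show ?thesis using that by blast
qed

lemma block_start_eq_iff [simp]:
  assumes "j < length Ls" "r < length (Ls ! j)" "j' < length Ls" "r' < length (Ls ! j')"
  shows "block_start Ls j + r = block_start Ls j' + r' \<longleftrightarrow> j = j' \<and> r = r'"
  using block_index_start[OF assms(1,2)] block_index_start[OF assms(3,4)] by (metis prod.inject)

context finitely_disjoint_restriction_category
begin

lemma entry_injn:
  "r < length (Ls ! j) \<Longrightarrow> c < length (concat Ls) \<Longrightarrow> entry (mmap_injn C Ls j) r c =
    (if c = block_start Ls j + r then ide C (Ls ! j ! r) else zer C (Ls ! j ! r) (concat Ls ! c))"
  by (simp add: mmap_injn_def block_start_def)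

lemma mat_injn_maps:
  assumes "set Ls \<subseteq> obj M" "j < length Ls"
  shows "mmap_injn C Ls j \<in> maps M (Ls ! j) (concat Ls)"
  unfolding mmap_injn_def block_start_def[symmetric]
proof (rule mat_mapsI)
  show L: "set (Ls ! j) \<subseteq> obj C" and cL: "set (concat Ls) \<subseteq> obj C"
    using assms nth_mem by auto
  fix r assume r: "r < length (Ls ! j)"
  have A: "Ls ! j ! r \<in> obj C" using L r nth_mem by blast
  have B: "concat Ls ! c \<in> obj C" if "c < length (concat Ls)" for c
    using cL that nth_mem by blast
  show "prow (Ls ! j ! r) (concat Ls) (\<lambda>c. if c = block_start Ls j + r then ide C (Ls ! j ! r)
      else zer C (Ls ! j ! r) (concat Ls ! c))"
    by (rule prow_single[where p = "block_start Ls j + r", OF A cL])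
      (use ide_maps[OF A] zer_maps[OF A B] r assms(2) in auto)
qed

text \<open>Row \<open>r\<close> of the injection has an identity at position
  \<open>block_start Ls j + r\<close> and zeroes elsewhere, so precomposition selects the rows of
  block \<open>j\<close>.\<close>

lemma entry_injn_cmp:
  assumes "set Ls \<subseteq> obj M" "j < length Ls" "H \<in> maps M (concat Ls) Bs"
    "r < length (Ls ! j)" "c < length Bs"
  shows "entry (mmap_cmp C (mmap_injn C Ls j) H) r c = entry H (block_start Ls j + r) c"
proof -
  let ?p = "block_start Ls j + r"
  note I = mat_injn_maps[OF assms(1,2)]
  have p: "?p < length (concat Ls)" using assms by simp
  have A: "Ls ! j ! r \<in> obj C" using mat_src_obj[OF I assms(4)] .
  have H: "entry H ?p c \<in> maps C (Ls ! j ! r) (Bs ! c)"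
    using mat_entry_maps[OF assms(3) p assms(5)] assms by simp
  have "is_join C (Ls ! j ! r) (Bs ! c) (length (concat Ls))
      (\<lambda>l. entry (mmap_injn C Ls j) r l \<cdot> entry H l c) (entry H ?p c)"
    by (rule is_join_single[OF p _ H])
      (simp_all add: entry_injn[OF assms(4) p] entry_injn[OF assms(4)] ide_left[OF H]
        zer_cmp[OF mat_entry_maps[OF assms(3) _ assms(5)] A])
  then show ?thesis
    using is_join_unique[OF entry_cmp_is_join[OF I assms(3-5)]] by simp
qed

text \<open>A column of the injection holds an identity only if it belongs to block
  \<open>k\<close>, so postcomposition places \<open>F\<close> in that block and pads it by zero
  columns.\<close>

lemma entry_cmp_injn:
  assumes "set Ls \<subseteq> obj M" "k < length Ls" "F \<in> maps M As (Ls ! k)"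
    "i < length As" "j < length Ls" "r < length (Ls ! j)"
  shows "entry (mmap_cmp C F (mmap_injn C Ls k)) i (block_start Ls j + r) =
    (if k = j then entry F i r else zer C (As ! i) (Ls ! j ! r))"
proof -
  let ?p = "block_start Ls j + r"
  note I = mat_injn_maps[OF assms(1,2)]
  have p: "?p < length (concat Ls)" using assms by simp
  have B: "Ls ! j ! r \<in> obj C" using mat_src_obj[OF mat_injn_maps[OF assms(1,5)] assms(6)] .
  have A: "As ! i \<in> obj C" using mat_src_obj[OF assms(3,4)] .
  note F = mat_entry_maps[OF assms(3,4)]
  have z: "entry F i l \<cdot> entry (mmap_injn C Ls k) l ?p = zer C (As ! i) (Ls ! j ! r)"
    if "l < length (Ls ! k)" "k = j \<longrightarrow> l \<noteq> r" for l
    using that entry_injn[OF that(1) p] cmp_zer[OF F[OF that(1)] B] assms by auto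
  have "is_join C (As ! i) (Ls ! j ! r) (length (Ls ! k))
      (\<lambda>l. entry F i l \<cdot> entry (mmap_injn C Ls k) l ?p)
      (if k = j then entry F i r else zer C (As ! i) (Ls ! j ! r))"
  proof (cases "k = j")
    case True
    have r: "r < length (Ls ! k)" using True assms by simp
    have "is_join C (As ! i) (Ls ! k ! r) (length (Ls ! k))
        (\<lambda>l. entry F i l \<cdot> entry (mmap_injn C Ls k) l ?p) (entry F i r)"
      by (rule is_join_single[OF r _ F[OF r]])
        (use z True entry_injn[OF r p] ide_right[OF F[OF r]] in auto)
    then show ?thesis using True by simp
  next
    case False
    have "is_join C (As ! i) (Ls ! j ! r) (length (Ls ! k))
        (\<lambda>l. entry F i l \<cdot> entry (mmap_injn C Ls k) l ?p) (zer C (As ! i) (Ls ! j ! r))"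
      by (rule is_join_zer[OF A B]) (use z False in auto)
    then show ?thesis using False by simp
  qed
  moreover have "concat Ls ! ?p = Ls ! j ! r" using assms by simp
  ultimately show ?thesis
    using is_join_unique[OF entry_cmp_is_join[OF assms(3) I assms(4) p]] by simp
qed

text \<open>The matrix \<open>?h\<close> stacks the \<open>f j\<close> vertically. Disjointness is a
  condition within rows, so stacking preserves it, and uniqueness holds because every row of the
  stack lies in exactly one block.\<close>

lemma mat_copair_ex1:
  assumes "set Ls \<subseteq> obj M" "set Bs \<subseteq> obj C"
    and f: "\<And>j. j < length Ls \<Longrightarrow> f j \<in> maps M (Ls ! j) Bs"
  shows "\<exists>!h. h \<in> maps M (concat Ls) Bs \<and> (\<forall>j<length Ls. mmap_cmp C (mmap_injn C Ls j) h = f j)"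
proof (rule ex_ex1I)
  let ?h = "mk_mmap (concat Ls) Bs
    (\<lambda>p c. entry (f (fst (block_index Ls p))) (snd (block_index Ls p)) c)"
  have cL: "set (concat Ls) \<subseteq> obj C" using assms(1) by auto
  have h: "?h \<in> maps M (concat Ls) Bs"
  proof (rule mat_mapsI[OF cL assms(2)])
    fix p assume "p < length (concat Ls)"
    then obtain j r where "j < length Ls" "r < length (Ls ! j)" "p = block_start Ls j + r"
      by (rule block_index_cases)
    then show "prow (concat Ls ! p) Bs
        (\<lambda>c. entry (f (fst (block_index Ls p))) (snd (block_index Ls p)) c)"
      using mat_maps_prow[OF f] by simp
  qed
  have "mmap_cmp C (mmap_injn C Ls j) ?h = f j" if j: "j < length Ls" for j
    by (rule mat_eqI[OF mat_cmp_maps[OF mat_injn_maps[OF assms(1) j] h] f[OF j]])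
      (use entry_injn_cmp[OF assms(1) j h] j in simp)
  then show "\<exists>h. h \<in> maps M (concat Ls) Bs \<and>
      (\<forall>j<length Ls. mmap_cmp C (mmap_injn C Ls j) h = f j)" using h by blast
next
  fix g h
  assume g: "g \<in> maps M (concat Ls) Bs \<and> (\<forall>j<length Ls. mmap_cmp C (mmap_injn C Ls j) g = f j)"
    and h: "h \<in> maps M (concat Ls) Bs \<and> (\<forall>j<length Ls. mmap_cmp C (mmap_injn C Ls j) h = f j)"
  show "g = h"
  proof (rule mat_eqI[OF conjunct1[OF g] conjunct1[OF h]])
    fix p c assume "p < length (concat Ls)" and c: "c < length Bs"
    then obtain j r where jr: "j < length Ls" "r < length (Ls ! j)" "p = block_start Ls j + r"
      by (metis block_index_cases)
    then show "entry g p c = entry h p c"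
      using entry_injn_cmp[OF assms(1) jr(1) conjunct1[OF g] jr(2) c]
        entry_injn_cmp[OF assms(1) jr(1) conjunct1[OF h] jr(2) c] g h by simp
  qed
qed

lemma mat_copair:
  assumes "set Ls \<subseteq> obj M" "set Bs \<subseteq> obj C"
    and f: "\<And>j. j < length Ls \<Longrightarrow> f j \<in> maps M (Ls ! j) Bs"
  shows "copair M Ls Bs f \<in> maps M (concat Ls) Bs"
    and "j < length Ls \<Longrightarrow> r < length (Ls ! j) \<Longrightarrow> c < length Bs \<Longrightarrow>
      entry (copair M Ls Bs f) (block_start Ls j + r) c = entry (f j) r c"
proof -
  have *: "copair M Ls Bs f \<in> maps M (concat Ls) Bs \<and>
      (\<forall>j<length Ls. mmap_cmp C (mmap_injn C Ls j) (copair M Ls Bs f) = f j)"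
    using theI'[OF mat_copair_ex1[OF assms]] by (simp add: copair_def)
  then show m: "copair M Ls Bs f \<in> maps M (concat Ls) Bs" by simp
  show "entry (copair M Ls Bs f) (block_start Ls j + r) c = entry (f j) r c"
    if "j < length Ls" "r < length (Ls ! j)" "c < length Bs"
    using entry_injn_cmp[OF assms(1) that(1) m that(2,3)] * that(1) by simp
qed

text \<open>Each row contains one identity and otherwise zeroes, so its row restriction is an
  identity.\<close>

lemma mat_injn_total:
  assumes "set Ls \<subseteq> obj M" "j < length Ls"
  shows "total_map M (mmap_injn C Ls j)"
proof -
  note I = mat_injn_maps[OF assms]
  have L: "ide C (Ls ! j ! r) \<in> maps C (Ls ! j ! r) (Ls ! j ! r)" if "r < length (Ls ! j)" for r
    using ide_maps mat_src_obj[OF I that] .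
  have "mmap_rst C (mmap_injn C Ls j) = diag_mmap C (Ls ! j) (\<lambda>r. ide C (Ls ! j ! r))"
  proof (rule mat_eqI[OF mat_rst_maps[OF I] diag_mat_maps[OF mat_maps_sel(3)[OF I] L]])
    fix r r' assume r: "r < length (Ls ! j)" and r': "r' < length (Ls ! j)"
    let ?p = "block_start Ls j + r"
    have p: "?p < length (concat Ls)" using assms r by simp
    have A: "Ls ! j ! r \<in> obj C" by (rule mat_src_obj[OF I r])
    have "is_join C (Ls ! j ! r) (Ls ! j ! r) (length (concat Ls))
        (\<lambda>c. rst C (entry (mmap_injn C Ls j) r c)) (ide C (Ls ! j ! r))"
      by (rule is_join_single[OF p _ L[OF r]])
        (simp_all add: entry_injn[OF r p] entry_injn[OF r] rst_ide[OF A] rst_zer[OF A mat_tgt_obj[OF I]])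
    then have "rrst (Ls ! j ! r) (concat Ls) (\<lambda>c. entry (mmap_injn C Ls j) r c) = ide C (Ls ! j ! r)"
      using is_join_unique[OF rrst_is_join[OF mat_maps_prow[OF I r]]] by simp
    then show "entry (mmap_rst C (mmap_injn C Ls j)) r r' =
        entry (diag_mmap C (Ls ! j) (\<lambda>r. ide C (Ls ! j ! r))) r r'"
      using entry_rst[OF I r r'] r r' by auto
  qed
  then show ?thesis
    using I mat_maps_sel(1)[OF I] by (simp add: total_map_def maps_def)
qed

lemma mat_cocartesian_restriction_category: "cocartesian_restriction_category M"
proof (rule cocartesian_restriction_category.intro[OF mat_restriction_category], unfold_locales, goal_cases)
  case (1 Ls) then show ?case by auto
next
  case (2 Ls j) then show ?case using mat_injn_maps[OF 2] by simp
next
  case (3 Ls Bs f)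
  then show ?case using mat_copair_ex1[OF 3(1) _ 3(3)] by simp
next
  case (4 Ls j) then show ?case using mat_injn_total[OF 4] by simp
qed

end

section \<open>Decisions\<close>

context finitely_disjoint_restriction_category
begin

lemma mat_codiag:
  assumes "set As \<subseteq> obj C"
  shows "codiag M n As \<in> maps M (concat (replicate n As)) As"
    and "k < n \<Longrightarrow> i < length As \<Longrightarrow> j < length As \<Longrightarrow>
      entry (codiag M n As) (block_start (replicate n As) k + i) j =
      (if i = j then ide C (As ! i) else zer C (As ! i) (As ! j))"
proof -
  have R: "set (replicate n As) \<subseteq> obj M" using assms by auto
  have I: "ide M As \<in> maps M (replicate n As ! k) As" if "k < length (replicate n As)" for k
    using category.ide_maps[OF mat_category, of As] that assms by simp
  show "codiag M n As \<in> maps M (concat (replicate n As)) As"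
    unfolding codiag_def by (rule mat_copair(1)[OF R assms I])
  show "entry (codiag M n As) (block_start (replicate n As) k + i) j =
      (if i = j then ide C (As ! i) else zer C (As ! i) (As ! j))"
    if "k < n" "i < length As" "j < length As"
    unfolding codiag_def by (subst mat_copair(2)[OF R assms I]) (use that in auto)
qed

lemma mat_summap:
  assumes "set Ls \<subseteq> obj M" "set Ks \<subseteq> obj M" "length Ks = length Ls"
    and f: "\<And>j. j < length Ls \<Longrightarrow> f j \<in> maps M (Ls ! j) (Ks ! j)"
  shows "summap M Ls Ks f \<in> maps M (concat Ls) (concat Ks)"
    and "j < length Ls \<Longrightarrow> r < length (Ls ! j) \<Longrightarrow> k < length Ls \<Longrightarrow> c < length (Ks ! k) \<Longrightarrow>
      entry (summap M Ls Ks f) (block_start Ls j + r) (block_start Ks k + c) =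
      (if j = k then entry (f j) r c else zer C (Ls ! j ! r) (Ks ! k ! c))"
proof -
  have K: "set (concat Ks) \<subseteq> obj C" using assms(2) by auto
  have g: "cmp M (f j) (injn M Ks j) \<in> maps M (Ls ! j) (concat Ks)" if "j < length Ls" for j
    using mat_cmp_maps[OF f[OF that] mat_injn_maps[OF assms(2)]] that assms(3) by simp
  show "summap M Ls Ks f \<in> maps M (concat Ls) (concat Ks)"
    unfolding summap_def using mat_copair(1)[OF assms(1) K g] by simp
  show "entry (summap M Ls Ks f) (block_start Ls j + r) (block_start Ks k + c) =
      (if j = k then entry (f j) r c else zer C (Ls ! j ! r) (Ks ! k ! c))"
    if "j < length Ls" "r < length (Ls ! j)" "k < length Ls" "c < length (Ks ! k)"
  proof -
    have "entry (summap M Ls Ks f) (block_start Ls j + r) (block_start Ks k + c) =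
        entry (cmp M (f j) (injn M Ks j)) r (block_start Ks k + c)"
      unfolding summap_def using mat_copair(2)[OF assms(1) K g that(1,2)] that assms(3) by simp
    then show ?thesis
      using entry_cmp_injn[OF assms(2) _ f[OF that(1)] that(2), of k c] that assms(3) by simp
  qed
qed

text \<open>The shape of a decision: \<open>n\<close> diagonal matrices side by side. Being a
  predicate on \<open>H\<close>, it serves both to recognise a given matrix and to specify one to be
  constructed.\<close>

definition block_diag :: "'a list \<Rightarrow> nat \<Rightarrow> (nat \<Rightarrow> nat \<Rightarrow> 'b) \<Rightarrow> ('a, 'b) mmap \<Rightarrow> bool" where
  "block_diag As n e H \<longleftrightarrow> H \<in> maps M As (concat (replicate n As)) \<and>
    (\<forall>i<length As. \<forall>k<n. \<forall>j<length As.
      entry H i (block_start (replicate n As) k + j) = (if i = j then e i k else zer C (As ! i) (As ! j)))"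

lemma block_index_replicate_cases:
  assumes "p < length (concat (replicate n As))"
  obtains k i where "k < n" "i < length As" "p = block_start (replicate n As) k + i"
  using assms by (elim block_index_cases) auto

lemma replicate_block_simps [simp]:
  assumes "k < n" "i < length As"
  shows "block_start (replicate n As) k + i < length (concat (replicate n As))"
    and "concat (replicate n As) ! (block_start (replicate n As) k + i) = As ! i"
    and "block_index (replicate n As) (block_start (replicate n As) k + i) = (k, i)"
  using assms block_start_less[of k "replicate n As" i] concat_nth_block[of k "replicate n As" i]
    block_index_start[of k "replicate n As" i] by auto

lemma block_diag_unique:
  assumes "block_diag As n e H" "block_diag As n e' H'"
    "\<And>i k. i < length As \<Longrightarrow> k < n \<Longrightarrow> e i k = e' i k"
  shows "H = H'"
proof (rule mat_eqI)
  show "H \<in> maps M As (concat (replicate n As))" "H' \<in> maps M As (concat (replicate n As))"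
    using assms by (auto simp: block_diag_def)
  fix i p assume i: "i < length As" and "p < length (concat (replicate n As))"
  from this(2) obtain k j where "k < n" "j < length As" "p = block_start (replicate n As) k + j"
    by (rule block_index_replicate_cases)
  then show "entry H i p = entry H' i p" using assms i by (simp add: block_diag_def)
qed

lemma block_diag_cong:
  "block_diag As n e H \<Longrightarrow> (\<And>i k. i < length As \<Longrightarrow> k < n \<Longrightarrow> e i k = e' i k) \<Longrightarrow> block_diag As n e' H"
  by (simp add: block_diag_def)

text \<open>Row \<open>i\<close> can be nonzero only at the \<open>e i k\<close>, one per block, so
  their mutual disjointness is what makes the row admissible.\<close>

lemma block_diag_exists:
  assumes "set As \<subseteq> obj C"
    and e: "\<And>i k. i < length As \<Longrightarrow> k < n \<Longrightarrow> e i k \<in> maps C (As ! i) (As ! i)"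
    and e_perp: "\<And>i k l. i < length As \<Longrightarrow> k < n \<Longrightarrow> l < n \<Longrightarrow> k \<noteq> l \<Longrightarrow> e i k \<perp> e i l"
  shows "\<exists>H. block_diag As n e H"
proof -
  let ?R = "replicate n As"
  define f where "f i p = (if i = snd (block_index ?R p) then e i (fst (block_index ?R p))
      else zer C (As ! i) (concat ?R ! p))" for i p
  have A: "As ! i \<in> obj C" if "i < length As" for i using assms(1) that nth_mem by blast
  have f: "f i (block_start ?R k + j) = (if i = j then e i k else zer C (As ! i) (As ! j))"
    if "k < n" "j < length As" for i k j
    using that by (simp add: f_def)
  have R: "set (concat ?R) \<subseteq> obj C" using assms(1) by auto
  have "mk_mmap As (concat ?R) f \<in> maps M As (concat ?R)"
  proof (rule mat_mapsI[OF assms(1) R])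
    fix i assume i: "i < length As"
    have m: "f i p \<in> maps C (As ! i) (concat ?R ! p)" if p: "p < length (concat ?R)" for p
      using p by (rule block_index_replicate_cases) (auto simp: f i intro: e[OF i] zer_maps[OF A[OF i] A])
    show "prow (As ! i) (concat ?R) (f i)"
      unfolding prow_def
    proof (intro conjI allI impI A[OF i] R m)
      fix p q assume p: "p < length (concat ?R)" and q: "q < length (concat ?R)" and pq: "p \<noteq> q"
      obtain k j where k: "k < n" "j < length As" "p = block_start ?R k + j"
        using p by (rule block_index_replicate_cases)
      obtain l j' where l: "l < n" "j' < length As" "q = block_start ?R l + j'"
        using q by (rule block_index_replicate_cases)
      show "f i p \<perp> f i q"
      proof (cases "j = i \<and> j' = i")
        case True
        then have "k \<noteq> l" using pq k l by auto
        then show ?thesis using e_perp[OF i k(1) l(1)] True f[OF k(1,2)] f[OF l(1,2)] k l by simp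
      next
        case False
        then have "f i p = zer C (As ! i) (As ! j) \<or> f i q = zer C (As ! i) (As ! j')"
          using f[OF k(1,2)] f[OF l(1,2)] k l by auto
        then show ?thesis using perp_zer(1)[OF m[OF p] A[OF l(2)]] perp_zer(2)[OF m[OF q] A[OF k(2)]]
          by auto
      qed
    qed
  qed
  then have "block_diag As n e (mk_mmap As (concat ?R) f)"
    unfolding block_diag_def using f by simp
  then show ?thesis ..
qed

lemma block_diag_entry_maps:
  assumes "block_diag As n e H" "i < length As" "k < n"
  shows "e i k \<in> maps C (As ! i) (As ! i)"
  using mat_entry_maps[of H As "concat (replicate n As)" i "block_start (replicate n As) k + i"] assms
  by (simp add: block_diag_def)

text \<open>Row \<open>i\<close> meets each block only at offset \<open>i\<close>; discarding the
  zero terms leaves a join over the \<open>n\<close> blocks.\<close>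

lemma entry_block_diag_cmp:
  assumes "block_diag As n e H" "G \<in> maps M (concat (replicate n As)) Ds"
    "i < length As" "c < length Ds"
  shows "is_join C (As ! i) (Ds ! c) n
    (\<lambda>k. e i k \<cdot> entry G (block_start (replicate n As) k + i) c) (entry (mmap_cmp C H G) i c)"
proof -
  let ?R = "replicate n As"
  have H: "H \<in> maps M As (concat ?R)" using assms(1) by (simp add: block_diag_def)
  have He: "entry H i (block_start ?R k + j) = (if i = j then e i k else zer C (As ! i) (As ! j))"
    if "k < n" "j < length As" for k j
    using assms(1,3) that by (simp add: block_diag_def)
  have "is_join C (As ! i) (Ds ! c) n
      (\<lambda>k. entry H i (block_start ?R k + i) \<cdot> entry G (block_start ?R k + i) c)
      (entry (mmap_cmp C H G) i c)"
  proof (rule iffD1[OF is_join_reindex entry_cmp_is_join[OF H assms(2-4)]])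
    show "block_start ?R k + i < length (concat ?R)" if "k < n" for k using that assms(3) by simp
    fix p assume p: "p < length (concat ?R)"
    then obtain k j where k: "k < n" "j < length As" "p = block_start ?R k + j"
      by (rule block_index_replicate_cases)
    show "(\<exists>k<n. p = block_start ?R k + i) \<or> entry H i p \<cdot> entry G p c = zer C (As ! i) (Ds ! c)"
    proof (cases "j = i")
      case False
      have "concat ?R ! p = As ! j" using k by simp
      then have "zer C (As ! i) (As ! j) \<cdot> entry G p c = zer C (As ! i) (Ds ! c)"
        using zer_cmp[OF mat_entry_maps[OF assms(2) p assms(4)] mat_src_obj[OF H assms(3)]] by simp
      then show ?thesis using False He[OF k(1,2)] k(3) by simp
    qed (use k in auto)
  qed
  then show ?thesis by (subst (asm) is_join_cong[of _ _ "\<lambda>k. e i k \<cdot> entry G (block_start ?R k + i) c"])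
      (use He assms(3) in auto)
qed

text \<open>This evaluates the left side of the second decision equation for a candidate
  \<open>H\<close>: in copy \<open>k\<close> of the target only block \<open>k\<close>
  contributes.\<close>

lemma entry_block_diag_summap:
  assumes "block_diag As n e H" "F \<in> maps M As Bs" "i < length As" "c < length Bs" "k < n"
  shows "entry (mmap_cmp C H (summap M (replicate n As) (replicate n Bs) (\<lambda>_. F))) i
    (block_start (replicate n Bs) k + c) = e i k \<cdot> entry F i c"
proof -
  let ?R = "replicate n As" and ?K = "replicate n Bs"
  let ?S = "summap M ?R ?K (\<lambda>_. F)"
  have R: "set ?R \<subseteq> obj M" and K: "set ?K \<subseteq> obj M" using mat_maps_sel(3,4)[OF assms(2)] by auto
  have F: "F \<in> maps M (?R ! j) (?K ! j)" if "j < length ?R" for j using that assms(2) by simp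
  have S: "?S \<in> maps M (concat ?R) (concat ?K)" by (rule mat_summap(1)[OF R K _ F]) auto
  have Se: "entry ?S (block_start ?R l + i) (block_start ?K k + c) =
      (if l = k then entry F i c else zer C (As ! i) (Bs ! c))" if "l < n" for l
    by (subst mat_summap(2)[OF R K _ F]) (use that assms in auto)
  note e = block_diag_entry_maps[OF assms(1,3)]
  have "is_join C (As ! i) (Bs ! c) n
      (\<lambda>l. e i l \<cdot> entry ?S (block_start ?R l + i) (block_start ?K k + c)) (e i k \<cdot> entry F i c)"
    by (rule is_join_single[OF assms(5) _ cmp_maps[OF e[OF assms(5)] mat_entry_maps[OF assms(2-4)]]])
      (simp_all add: Se assms(5) cmp_zer[OF e mat_tgt_obj[OF assms(2,4)]])
  then show ?thesis
    using is_join_unique[OF entry_block_diag_cmp[OF assms(1) S assms(3)]] assms(4,5) by simp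
qed

text \<open>The right side of that equation: the sum of the injections sends block \<open>k\<close>
  of \<open>concat Ls\<close> into the \<open>k\<close>-th copy of \<open>concat Ls\<close>, so an
  entry of \<open>F\<close> survives only in the copy numbered by its own block.\<close>

lemma entry_cmp_summap_injn:
  assumes "set Ls \<subseteq> obj M" "F \<in> maps M As (concat Ls)" "i < length As" "c < length (concat Ls)"
    "k < length Ls"
  shows "entry (mmap_cmp C F (summap M Ls (replicate (length Ls) (concat Ls)) (\<lambda>j. mmap_injn C Ls j)))
      i (block_start (replicate (length Ls) (concat Ls)) k + c) =
    (if fst (block_index Ls c) = k then entry F i c else zer C (As ! i) (concat Ls ! c))"
proof -
  let ?n = "length Ls" and ?B = "concat Ls"
  let ?K = "replicate ?n ?B"
  let ?T = "summap M Ls ?K (\<lambda>j. mmap_injn C Ls j)" and ?q = "block_start ?K k + c"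
  have K: "set ?K \<subseteq> obj M" using mat_maps_sel(4)[OF assms(2)] by auto
  have I: "mmap_injn C Ls j \<in> maps M (Ls ! j) (?K ! j)" if "j < length Ls" for j
    using that mat_injn_maps[OF assms(1)] by simp
  have T: "?T \<in> maps M ?B (concat ?K)" by (rule mat_summap(1)[OF assms(1) K _ I]) auto
  have q: "?q < length (concat ?K)" "concat ?K ! ?q = ?B ! c" using assms(4,5) by auto
  \<comment> \<open>Column \<open>?q\<close> is nonzero at most in row \<open>c\<close>, where it
    holds an identity if \<open>c\<close> lies in block \<open>k\<close>.\<close>
  have Te: "entry ?T p ?q = (if fst (block_index Ls p) = k \<and> c = p then ide C (?B ! p)
      else zer C (?B ! p) (?B ! c))" if "p < length ?B" for p
  proof -
    obtain j r where j: "j < length Ls" "r < length (Ls ! j)" "p = block_start Ls j + r"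
      using \<open>p < length ?B\<close> by (rule block_index_cases)
    have "entry ?T p ?q = (if j = k then entry (mmap_injn C Ls j) r c
        else zer C (Ls ! j ! r) (?K ! k ! c))"
      unfolding j(3) by (rule mat_summap(2)[OF assms(1) K _ I]) (use j assms in auto)
    then show ?thesis using entry_injn[OF j(2) assms(4)] j assms(5) by auto
  qed
  note F = mat_entry_maps[OF assms(2,3)]
  have B: "?B ! c \<in> obj C" by (rule mat_tgt_obj[OF assms(2,4)])
  have "is_join C (As ! i) (?B ! c) (length ?B) (\<lambda>p. entry F i p \<cdot> entry ?T p ?q)
      (if fst (block_index Ls c) = k then entry F i c else zer C (As ! i) (?B ! c))"
  proof (cases "fst (block_index Ls c) = k")
    case True
    have "is_join C (As ! i) (?B ! c) (length ?B) (\<lambda>p. entry F i p \<cdot> entry ?T p ?q) (entry F i c)"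
      by (rule is_join_single[OF assms(4) _ F[OF assms(4)]])
        (simp_all add: Te assms(4) True ide_right[OF F[OF assms(4)]] cmp_zer[OF F B])
    then show ?thesis using True by simp
  next
    case False
    have "is_join C (As ! i) (?B ! c) (length ?B) (\<lambda>p. entry F i p \<cdot> entry ?T p ?q)
        (zer C (As ! i) (?B ! c))"
      by (rule is_join_zer[OF mat_src_obj[OF assms(2,3)] B])
        (use Te False cmp_zer[OF F B] in auto)
    then show ?thesis using False by simp
  qed
  then show ?thesis
    using is_join_unique[OF entry_cmp_is_join[OF assms(2) T assms(3) q(1)]] q(2) by simp
qed

text \<open>The part of the row restriction belonging to summand \<open>k\<close>. The join runs
  over all columns, padded by zeroes, so that its index range does not depend on \<open>k\<close>
  and \<open>is_join_swap\<close> applies.\<close>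

definition block_rst :: "'a \<Rightarrow> 'a list list \<Rightarrow> (nat \<Rightarrow> 'b) \<Rightarrow> nat \<Rightarrow> 'b" where
  "block_rst A Ls f k = djoin C A A (length (concat Ls))
    (\<lambda>c. if fst (block_index Ls c) = k then rst C (f c) else zer C A A)"

lemma block_rst_family:
  assumes "prow A (concat Ls) f"
  shows "perp_family C perp A A (length (concat Ls))
    (\<lambda>c. if fst (block_index Ls c) = k then rst C (f c) else zer C A A)"
  unfolding perp_family_def
proof (intro conjI allI impI)
  show A: "A \<in> obj C" "A \<in> obj C" using assms by (simp_all add: prow_def)
  have r: "rst C (f c) \<in> maps C A A" if "c < length (concat Ls)" for c
    by (rule rst_maps[OF prow_maps[OF assms that]])
  show "(if fst (block_index Ls c) = k then rst C (f c) else zer C A A) \<in> maps C A A"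
    if "c < length (concat Ls)" for c
    using r[OF that] zer_maps[OF A] by simp
  show "(if fst (block_index Ls c) = k then rst C (f c) else zer C A A) \<perp>
      (if fst (block_index Ls c') = k then rst C (f c') else zer C A A)"
    if "c < length (concat Ls)" "c' < length (concat Ls)" "c \<noteq> c'" for c c'
    using perp_rst[OF prow_perp[OF assms that]] perp_zer[OF r[OF that(1)] A(1)]
      perp_zer[OF r[OF that(2)] A(1)] perp_zer[OF zer_maps[OF A] A(1)] by simp
qed

lemma block_rst_is_join:
  "prow A (concat Ls) f \<Longrightarrow> is_join C A A (length (concat Ls))
    (\<lambda>c. if fst (block_index Ls c) = k then rst C (f c) else zer C A A) (block_rst A Ls f k)"
  unfolding block_rst_def by (rule djoin_is_join[OF block_rst_family])

text \<open>For equal columns one of the two terms is zero, as a column lies in only one block; for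
  different columns the row itself is disjoint.\<close>

lemma block_rst_perp:
  assumes "prow A (concat Ls) f" "k \<noteq> l"
  shows "block_rst A Ls f k \<perp> block_rst A Ls f l"
proof (rule is_join_perp_is_join[OF block_rst_family[OF assms(1)] block_rst_is_join[OF assms(1)]
      block_rst_family[OF assms(1)] block_rst_is_join[OF assms(1)]])
  fix c c' assume c: "c < length (concat Ls)" "c' < length (concat Ls)"
  have A: "A \<in> obj C" using assms by (simp add: prow_def)
  have r: "rst C (f c) \<in> maps C A A" if "c < length (concat Ls)" for c
    by (rule rst_maps[OF prow_maps[OF assms(1) that]])
  show "(if fst (block_index Ls c) = k then rst C (f c) else zer C A A) \<perp>
      (if fst (block_index Ls c') = l then rst C (f c') else zer C A A)"
    using perp_rst[OF prow_perp[OF assms(1) c]] perp_zer[OF r[OF c(1)] A]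
      perp_zer[OF r[OF c(2)] A] perp_zer[OF zer_maps[OF A A] A] assms(2) by (cases "c = c'") auto
qed

text \<open>Each column belongs to one block, so joining over \<open>k\<close> first leaves a single
  term per column; the interchange does the rest.\<close>

lemma block_rst_joins_rrst:
  assumes "prow A (concat Ls) f"
  shows "is_join C A A (length Ls) (\<lambda>k. block_rst A Ls f k) (rrst A (concat Ls) f)"
proof (rule is_join_swap[OF _ rrst_is_join[OF assms] block_rst_is_join[OF assms]])
  fix c assume c: "c < length (concat Ls)"
  then obtain j r where j: "j < length Ls" "r < length (Ls ! j)" "c = block_start Ls j + r"
    by (rule block_index_cases)
  show "is_join C A A (length Ls) (\<lambda>k. if fst (block_index Ls c) = k then rst C (f c) else zer C A A)
      (rst C (f c))"
    by (rule is_join_single[OF j(1) _ rst_maps[OF prow_maps[OF assms c]]]) (use j in auto)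
qed

text \<open>Terms from other columns are annihilated by disjointness, so the product is
  \<open>rst C (f c) \<cdot> f c\<close> or zero according to the block of \<open>c\<close>.\<close>

lemma block_rst_cmp:
  assumes "prow A (concat Ls) f" "c < length (concat Ls)"
  shows "block_rst A Ls f k \<cdot> f c =
    (if fst (block_index Ls c) = k then f c else zer C A (concat Ls ! c))"
proof -
  let ?g = "\<lambda>c. if fst (block_index Ls c) = k then rst C (f c) else zer C A A"
  note f = prow_maps[OF assms(1)]
  have A: "A \<in> obj C" and B: "concat Ls ! c \<in> obj C"
    using maps_src_obj[OF f[OF assms(2)]] maps_tgt_obj[OF f[OF assms(2)]] by auto
  have z: "?g c' \<cdot> f c = zer C A (concat Ls ! c)"
    if "c' < length (concat Ls)" "c' = c \<longrightarrow> fst (block_index Ls c) \<noteq> k" for c'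
    using perp_rst_cmp_zer[OF prow_perp[OF assms(1) that(1) assms(2)] f[OF that(1)] f[OF assms(2)]]
      zer_cmp[OF f[OF assms(2)] A] that by auto
  have "is_join C A (concat Ls ! c) (length (concat Ls)) (\<lambda>c'. ?g c' \<cdot> f c) (block_rst A Ls f k \<cdot> f c)"
    by (rule is_join_cmp_right[OF block_rst_family[OF assms(1)] block_rst_is_join[OF assms(1)] f[OF assms(2)]])
  moreover have "is_join C A (concat Ls ! c) (length (concat Ls)) (\<lambda>c'. ?g c' \<cdot> f c)
      (if fst (block_index Ls c) = k then f c else zer C A (concat Ls ! c))"
  proof (cases "fst (block_index Ls c) = k")
    case True
    have "is_join C A (concat Ls ! c) (length (concat Ls)) (\<lambda>c'. ?g c' \<cdot> f c) (f c)"
    proof (rule is_join_single[OF assms(2) _ f[OF assms(2)]])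
      show "?g c \<cdot> f c = f c" using True rst_cmp[OF f[OF assms(2)]] by simp
    qed (rule z, simp_all)
    then show ?thesis using True by simp
  next
    case False
    have "is_join C A (concat Ls ! c) (length (concat Ls)) (\<lambda>c'. ?g c' \<cdot> f c) (zer C A (concat Ls ! c))"
      by (rule is_join_zer[OF A B], rule z) (use False in simp_all)
    then show ?thesis using False by simp
  qed
  ultimately show ?thesis by (rule is_join_unique)
qed

text \<open>Below the row restriction, \<open>e\<close> is the join of the restrictions of the
  \<open>e \<cdot> f c\<close>, and these are prescribed. For a decision, the bound comes from the
  codiagonal equation and the products from the second equation.\<close>

lemma block_rst_unique:
  assumes "prow A (concat Ls) f" "rle C e (rrst A (concat Ls) f)"
    and ef: "\<And>c. c < length (concat Ls) \<Longrightarrow>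
      e \<cdot> f c = (if fst (block_index Ls c) = k then f c else zer C A (concat Ls ! c))"
  shows "e = block_rst A Ls f k"
proof -
  let ?r = "rrst A (concat Ls) f"
  have A: "A \<in> obj C" using assms(1) by (simp add: prow_def)
  note r = ridem_rrst[OF assms(1)] and f = prow_maps[OF assms(1)]
  have "ridem A e" using rle_ide_ridem[OF rle_trans[OF assms(2) ridem_rle_ide[OF r]] A] .
  note e = this ridem_maps[OF this]
  have "e \<cdot> ?r = e" using assms(2) rle_iff[OF e(2) ridem_maps[OF r]] e(1) by (simp add: ridem_def)
  then have j: "is_join C A A (length (concat Ls)) (\<lambda>c. e \<cdot> rst C (f c)) e"
    using is_join_cmp_left[OF prow_family_rst[OF assms(1)] rrst_is_join[OF assms(1)] e(2)] by simp
  have "e \<cdot> rst C (f c) = (if fst (block_index Ls c) = k then rst C (f c) else zer C A A)"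
    if "c < length (concat Ls)" for c
    using rst_ridem_cmp[OF e(1) f[OF that]] ef[OF that] rst_zer[OF A maps_tgt_obj[OF f[OF that]]]
    by (auto split: if_splits)
  then have "is_join C A A (length (concat Ls))
      (\<lambda>c. if fst (block_index Ls c) = k then rst C (f c) else zer C A A) e"
    using j by (subst (asm) is_join_cong) auto
  then show ?thesis using is_join_unique[OF block_rst_is_join[OF assms(1)]] by simp
qed

text \<open>The decision of \<open>F\<close> sends row \<open>i\<close> to the \<open>k\<close>-th copy of itself, restricted to where the
  row takes values in the \<open>k\<close>-th summand.\<close>

lemma mat_is_dec_iff:
  assumes "set Ls \<subseteq> obj M" "F \<in> maps M As (concat Ls)"
  shows "is_dec M Ls F H \<longleftrightarrow>
    block_diag As (length Ls) (\<lambda>i k. block_rst (As ! i) Ls (\<lambda>c. entry F i c) k) H"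
proof -
  let ?n = "length Ls" and ?B = "concat Ls"
  let ?R = "replicate ?n As" and ?K = "replicate ?n ?B"
  let ?S = "summap M ?R ?K (\<lambda>_. F)" and ?T = "summap M Ls ?K (\<lambda>j. mmap_injn C Ls j)"
  let ?E = "\<lambda>i k. block_rst (As ! i) Ls (\<lambda>c. entry F i c) k"
  note A = mat_maps_sel(3)[OF assms(2)] and row = mat_maps_prow[OF assms(2)]
  have dec: "is_dec M Ls F H \<longleftrightarrow> H \<in> maps M As (concat ?R) \<and>
      mmap_rst C F = mmap_cmp C H (codiag M ?n As) \<and> mmap_cmp C H ?S = mmap_cmp C F ?T" for H
    using mat_maps_sel(1)[OF assms(2)] by (simp add: is_dec_def Let_def)
  note cod = mat_codiag[OF A]
  show ?thesis
  proof
    assume "is_dec M Ls F H"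
    then have H: "H \<in> maps M As (concat ?R)" and r: "mmap_rst C F = mmap_cmp C H (codiag M ?n As)"
      and ST: "mmap_cmp C H ?S = mmap_cmp C F ?T" by (simp_all add: dec)
    \<comment> \<open>Composing with the codiagonal joins the blocks, so every entry of
      \<open>H\<close> lies below the matching entry of the restriction of \<open>F\<close>. Off the
      diagonal the latter is zero, which forces the block shape.\<close>
    have le: "rle C (entry H i (block_start ?R k + j)) (entry (mmap_rst C F) i j)"
      if i: "i < length As" and k: "k < ?n" and j: "j < length As" for i k j
    proof -
      let ?p = "block_start ?R k + j"
      have p: "?p < length (concat ?R)" using k j by simp
      have "rle C (entry H i ?p \<cdot> entry (codiag M ?n As) ?p j) (entry (mmap_rst C F) i j)"
        unfolding r by (rule is_join_upper[OF entry_cmp_is_join[OF H cod(1) i j] p])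
      moreover have "entry H i ?p \<in> maps C (As ! i) (As ! j)"
        using mat_entry_maps[OF H i p] k j by simp
      ultimately show ?thesis using cod(2)[OF k j j] ide_right by simp
    qed
    have bd: "block_diag As ?n (\<lambda>i k. entry H i (block_start ?R k + i)) H"
      unfolding block_diag_def
    proof (intro conjI allI impI H)
      fix i k j assume i: "i < length As" and k: "k < ?n" and j: "j < length As"
      show "entry H i (block_start ?R k + j) =
          (if i = j then entry H i (block_start ?R k + i) else zer C (As ! i) (As ! j))"
        using le[OF i k j] entry_rst[OF assms(2) i j]
          rle_zer[OF _ mat_src_obj[OF assms(2) i] mat_src_obj[OF assms(2) j]] by auto
    qed
    have "entry H i (block_start ?R k + i) = ?E i k" if i: "i < length As" and k: "k < ?n" for i k
    proof (rule block_rst_unique[OF row[OF i]])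
      show "rle C (entry H i (block_start ?R k + i)) (rrst (As ! i) ?B (\<lambda>c. entry F i c))"
        using le[OF i k i] entry_rst[OF assms(2) i i] by simp
      fix c assume c: "c < length ?B"
      show "entry H i (block_start ?R k + i) \<cdot> entry F i c =
          (if fst (block_index Ls c) = k then entry F i c else zer C (As ! i) (?B ! c))"
        using entry_block_diag_summap[OF bd assms(2) i c k] entry_cmp_summap_injn[OF assms i c k] ST
        by simp
    qed
    then show "block_diag As ?n ?E H" by (rule block_diag_cong[OF bd])
  next
    assume bd: "block_diag As ?n ?E H"
    then have H: "H \<in> maps M As (concat ?R)" by (simp add: block_diag_def)
    \<comment> \<open>The codiagonal equation holds because the block restrictions of a row join to
      its full restriction.\<close>
    have "mmap_rst C F = mmap_cmp C H (codiag M ?n As)"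
    proof (rule mat_eqI[OF mat_rst_maps[OF assms(2)] mat_cmp_maps[OF H cod(1)]])
      fix i j assume i: "i < length As" and j: "j < length As"
      let ?f = "\<lambda>k. ?E i k \<cdot> entry (codiag M ?n As) (block_start ?R k + i) j"
      note e = block_diag_entry_maps[OF bd i]
      have "is_join C (As ! i) (As ! j) ?n ?f (entry (mmap_rst C F) i j)"
      proof (cases "i = j")
        case True
        have "?f k = ?E i k" if "k < ?n" for k
          using cod(2)[OF that i j] True ide_right[OF e[OF that]] by simp
        then have "is_join C (As ! i) (As ! i) ?n ?f (rrst (As ! i) ?B (\<lambda>c. entry F i c))"
          using block_rst_joins_rrst[OF row[OF i]] by (subst is_join_cong) auto
        then show ?thesis using entry_rst[OF assms(2) i j] True by simp
      next
        case False
        have "?f k = zer C (As ! i) (As ! j)" if "k < ?n" for k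
          using cod(2)[OF that i j] False cmp_zer[OF e[OF that] mat_src_obj[OF assms(2) j]] by simp
        then have "is_join C (As ! i) (As ! j) ?n ?f (zer C (As ! i) (As ! j))"
          by (rule is_join_zer[OF mat_src_obj[OF assms(2) i] mat_src_obj[OF assms(2) j]])
        then show ?thesis using entry_rst[OF assms(2) i j] False by simp
      qed
      then show "entry (mmap_rst C F) i j = entry (mmap_cmp C H (codiag M ?n As)) i j"
        using is_join_unique[OF entry_block_diag_cmp[OF bd cod(1) i j]] by simp
    qed
    moreover have "mmap_cmp C H ?S = mmap_cmp C F ?T"
    proof (rule mat_eqI)
      have R: "set ?R \<subseteq> obj M" and K: "set ?K \<subseteq> obj M" using mat_maps_sel(3,4)[OF assms(2)] by auto
      have "?S \<in> maps M (concat ?R) (concat ?K)"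
        by (rule mat_summap(1)[OF R K]) (use assms(2) in auto)
      then show "mmap_cmp C H ?S \<in> maps M As (concat ?K)" by (rule mat_cmp_maps[OF H])
      have "?T \<in> maps M ?B (concat ?K)"
        by (rule mat_summap(1)[OF assms(1) K]) (use mat_injn_maps[OF assms(1)] in auto)
      then show "mmap_cmp C F ?T \<in> maps M As (concat ?K)" by (rule mat_cmp_maps[OF assms(2)])
      fix i p assume i: "i < length As" and "p < length (concat ?K)"
      from this(2) obtain k c where k: "k < ?n" "c < length ?B" "p = block_start ?K k + c"
        by (rule block_index_replicate_cases)
      show "entry (mmap_cmp C H ?S) i p = entry (mmap_cmp C F ?T) i p"
        using entry_block_diag_summap[OF bd assms(2) i k(2,1)]
          entry_cmp_summap_injn[OF assms i k(2,1)] block_rst_cmp[OF row[OF i] k(2)] k(3) by simp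
    qed
    ultimately show "is_dec M Ls F H" using H by (simp add: dec)
  qed
qed

lemma mat_dec_ex1:
  assumes "set Ls \<subseteq> obj M" "F \<in> maps M As (concat Ls)"
  shows "\<exists>!H. is_dec M Ls F H"
proof (rule ex_ex1I)
  show "\<exists>H. is_dec M Ls F H"
    unfolding mat_is_dec_iff[OF assms]
    by (rule block_diag_exists[OF mat_maps_sel(3)[OF assms(2)]
          is_join_maps[OF block_rst_is_join[OF mat_maps_prow[OF assms(2)]]]
          block_rst_perp[OF mat_maps_prow[OF assms(2)]]])
  show "H = H'" if "is_dec M Ls F H" "is_dec M Ls F H'" for H H'
    using that block_diag_unique unfolding mat_is_dec_iff[OF assms] by blast
qed

lemma mat_extensive_restriction_category: "extensive_restriction_category M"
  by (rule extensive_restriction_category.intro[OF mat_cocartesian_restriction_category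
        mat_restriction_category_zeroes], unfold_locales) (use mat_dec_ex1 in simp)

end

section \<open>Interference and joins of matrices\<close>

context finitely_disjoint_restriction_category
begin

section \<open>Quasi-projections and the relation \<open>perp_d\<close>\<close>

lemma mat_quasiproj:
  assumes "set As \<subseteq> obj C" "j < n"
  shows "quasiproj M (replicate n As) j \<in> maps M (concat (replicate n As)) As"
    and "k < n \<Longrightarrow> r < length As \<Longrightarrow> c < length As \<Longrightarrow>
      entry (quasiproj M (replicate n As) j) (block_start (replicate n As) k + r) c =
      (if k = j \<and> r = c then ide C (As ! r) else zer C (As ! r) (As ! c))"
proof -
  let ?R = "replicate n As"
  let ?f = "\<lambda>i. if i = j then ide M (?R ! j) else zer M (?R ! i) (?R ! j)"
  have R: "set ?R \<subseteq> obj M" using assms by auto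
  have "ide M As \<in> maps M As As" using category.ide_maps[OF mat_category, of As] assms by simp
  moreover have "zer M As As \<in> maps M As As" using mat_zer_maps[OF assms(1,1)] by simp
  ultimately have f: "?f i \<in> maps M (?R ! i) As" if "i < length ?R" for i
    using that assms(2) by simp
  have q: "quasiproj M ?R j = copair M ?R As ?f" using assms(2) by (simp add: quasiproj_def)
  show "quasiproj M ?R j \<in> maps M (concat ?R) As"
    unfolding q by (rule mat_copair(1)[OF R assms(1) f])
  show "entry (quasiproj M ?R j) (block_start ?R k + r) c =
      (if k = j \<and> r = c then ide C (As ! r) else zer C (As ! r) (As ! c))"
    if "k < n" "r < length As" "c < length As"
    unfolding q by (subst mat_copair(2)[OF R assms(1) f]) (use that assms(2) in auto)
qed

text \<open>The quasi-projection is an identity on block \<open>k\<close> and zero elsewhere, so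
  composing with it extracts the columns of that block.\<close>

lemma entry_cmp_quasiproj:
  assumes "H \<in> maps M As (concat (replicate n Bs))" "k < n" "i < length As" "j < length Bs"
  shows "entry (mmap_cmp C H (quasiproj M (replicate n Bs) k)) i j =
    entry H i (block_start (replicate n Bs) k + j)"
proof -
  let ?R = "replicate n Bs"
  have B: "set Bs \<subseteq> obj C" using mat_maps_sel(4)[OF assms(1)] assms(2) by auto
  note q = mat_quasiproj[OF B assms(2)]
  have p: "block_start ?R k + j < length (concat ?R)" using assms by simp
  note H = mat_entry_maps[OF assms(1,3)]
  have Hp: "entry H i (block_start ?R k + j) \<in> maps C (As ! i) (Bs ! j)" using H[OF p] assms by simp
  have "is_join C (As ! i) (Bs ! j) (length (concat ?R))
      (\<lambda>p. entry H i p \<cdot> entry (quasiproj M ?R k) p j) (entry H i (block_start ?R k + j))"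
  proof (rule is_join_single[OF p _ Hp])
    show "entry H i (block_start ?R k + j) \<cdot> entry (quasiproj M ?R k) (block_start ?R k + j) j =
        entry H i (block_start ?R k + j)"
      using q(2)[OF assms(2,4,4)] ide_right[OF Hp] by simp
    fix p assume p: "p < length (concat ?R)" "p \<noteq> block_start ?R k + j"
    obtain l r where l: "l < n" "r < length Bs" "p = block_start ?R l + r"
      using p(1) by (rule block_index_replicate_cases)
    then have "entry (quasiproj M ?R k) p j = zer C (concat ?R ! p) (Bs ! j)"
      using q(2)[OF l(1,2) assms(4)] p(2) by auto
    then show "entry H i p \<cdot> entry (quasiproj M ?R k) p j = zer C (As ! i) (Bs ! j)"
      using cmp_zer[OF H[OF p(1)] mat_tgt_obj[OF q(1) assms(4)]] by simp
  qed
  then show ?thesis using is_join_unique[OF entry_cmp_is_join[OF assms(1) q(1) assms(3,4)]] by simp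
qed

text \<open>In row \<open>i\<close>, block \<open>k\<close> of \<open>D\<close> has
  \<open>e i k\<close> as its only possibly nonzero entry, and this is its own restriction; so the
  block restrictions of \<open>D\<close> are again the \<open>e i k\<close>.\<close>

lemma block_diag_decision:
  assumes "block_diag As n e D" "\<And>i k. i < length As \<Longrightarrow> k < n \<Longrightarrow> ridem (As ! i) (e i k)"
  shows "decision M As n D"
proof -
  let ?R = "replicate n As"
  have D: "D \<in> maps M As (concat ?R)" using assms(1) by (simp add: block_diag_def)
  have R: "set ?R \<subseteq> obj M" using mat_maps_sel(3)[OF D] by auto
  have "is_dec M ?R D D"
    unfolding mat_is_dec_iff[OF R D] length_replicate
  proof (rule block_diag_cong[OF assms(1)])
    fix i k assume i: "i < length As" and k: "k < n"
    note A = mat_src_obj[OF D i]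
    have p: "block_start ?R k + i < length (concat ?R)" using i k by simp
    have "is_join C (As ! i) (As ! i) (length (concat ?R))
        (\<lambda>p. if fst (block_index ?R p) = k then rst C (entry D i p) else zer C (As ! i) (As ! i)) (e i k)"
    proof (rule is_join_single[OF p _ ridem_maps[OF assms(2)[OF i k]]])
      show "(if fst (block_index ?R (block_start ?R k + i)) = k
          then rst C (entry D i (block_start ?R k + i)) else zer C (As ! i) (As ! i)) = e i k"
        using assms(1) assms(2)[OF i k] i k by (simp add: block_diag_def ridem_def)
      fix p assume p: "p < length (concat ?R)" "p \<noteq> block_start ?R k + i"
      obtain l r where l: "l < n" "r < length As" "p = block_start ?R l + r"
        using p(1) by (rule block_index_replicate_cases)
      show "(if fst (block_index ?R p) = k then rst C (entry D i p) else zer C (As ! i) (As ! i)) =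
          zer C (As ! i) (As ! i)"
        using assms(1) i l p(2) rst_zer[OF A mat_src_obj[OF D l(2)]] by (auto simp: block_diag_def)
    qed
    then show "e i k = block_rst (As ! i) ?R (\<lambda>c. entry D i c) k"
      using is_join_unique[OF block_rst_is_join[OF mat_maps_prow[OF D i]]] by simp
  qed
  then have "dec M ?R D = D"
    unfolding dec_def by (rule the1_equality[OF mat_dec_ex1[OF R D]])
  then show ?thesis using D by (simp add: decision_def)
qed

text \<open>From joins to entries, each \<open>rst C (f j)\<close> lies below the row restriction;
  from entries to joins, strength applies.\<close>

lemma rrst_perp_iff:
  assumes "prow A Bs f" "prow A Ds g"
  shows "rrst A Bs f \<perp> rrst A Ds g \<longleftrightarrow> (\<forall>j<length Bs. \<forall>k<length Ds. f j \<perp> g k)"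
proof (intro iffI allI impI)
  fix j k assume "rrst A Bs f \<perp> rrst A Ds g" and j: "j < length Bs" and k: "k < length Ds"
  then have "rst C (f j) \<perp> rst C (g k)"
    using perp_down is_join_upper[OF rrst_is_join[OF assms(1)] j]
      is_join_upper[OF rrst_is_join[OF assms(2)] k] by blast
  then show "f j \<perp> g k" using perp_rst_iff[OF prow_maps[OF assms(1) j] prow_maps[OF assms(2) k]] by simp
next
  assume "\<forall>j<length Bs. \<forall>k<length Ds. f j \<perp> g k"
  then show "rrst A Bs f \<perp> rrst A Ds g"
    by (intro is_join_perp_is_join[OF prow_family_rst[OF assms(1)] rrst_is_join[OF assms(1)]
          prow_family_rst[OF assms(2)] rrst_is_join[OF assms(2)]] perp_rst) blast
qed

text \<open>The blocks of a witnessing decision are the restrictions of \<open>F\<close> and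
  \<open>G\<close>, whose \<open>i\<close>-th diagonal entries sit in one row of a matrix, hence are
  disjoint. Conversely, disjointness lets these restrictions be put side by side, and
  \<open>block_diag_decision\<close> applies.\<close>

lemma mat_perp_d_iff_rrst:
  assumes "F \<in> maps M As Bs" "G \<in> maps M As Ds"
  shows "perp_d M F G \<longleftrightarrow> (\<forall>i<length As.
    rrst (As ! i) Bs (\<lambda>j. entry F i j) \<perp> rrst (As ! i) Ds (\<lambda>j. entry G i j))"
proof -
  let ?R = "replicate 2 As"
  let ?f = "\<lambda>i. rrst (As ! i) Bs (\<lambda>j. entry F i j)" and ?g = "\<lambda>i. rrst (As ! i) Ds (\<lambda>j. entry G i j)"
  have R: "[As, As] = ?R" by (simp add: numeral_2_eq_2)
  have perp_d: "perp_d M F G \<longleftrightarrow> (\<exists>d. decision M As 2 d \<and>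
      mmap_cmp C d (quasiproj M ?R 0) = mmap_rst C F \<and> mmap_cmp C d (quasiproj M ?R 1) = mmap_rst C G)"
    using assms by (simp add: perp_d_def R maps_def)
  show ?thesis
  proof
    assume "perp_d M F G"
    then obtain d where d: "decision M As 2 d" "mmap_cmp C d (quasiproj M ?R 0) = mmap_rst C F"
      "mmap_cmp C d (quasiproj M ?R 1) = mmap_rst C G"
      unfolding perp_d by blast
    have D: "d \<in> maps M As (concat ?R)" using d(1) by (simp add: decision_def)
    show "\<forall>i<length As. ?f i \<perp> ?g i"
    proof (intro allI impI)
      fix i assume i: "i < length As"
      have "entry d i (block_start ?R 0 + i) = ?f i"
        using entry_cmp_quasiproj[OF D _ i i, of 0] d(2) entry_rst[OF assms(1) i i] by simp
      moreover have "entry d i (block_start ?R 1 + i) = ?g i"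
        using entry_cmp_quasiproj[OF D _ i i, of 1] d(3) entry_rst[OF assms(2) i i] by simp
      moreover have "entry d i (block_start ?R 0 + i) \<perp> entry d i (block_start ?R 1 + i)"
      proof (rule prow_perp[OF mat_maps_prow[OF D i]])
        show "block_start ?R 0 + i \<noteq> block_start ?R 1 + i"
          using block_start_eq_iff[of 0 ?R i 1 i] i by simp
      \<comment> \<open>\<open>block_start_simps\<close> would rewrite
        \<open>block_start ?R 0\<close> away, and the facts about \<open>replicate\<close> would no
        longer match.\<close>
      qed (use i in \<open>simp_all del: block_start_simps add: replicate_block_simps\<close>)
      ultimately show "?f i \<perp> ?g i" by simp
    qed
  next
    assume *: "\<forall>i<length As. ?f i \<perp> ?g i"
    let ?e = "\<lambda>i k. if k = (0::nat) then ?f i else ?g i"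
    have e: "ridem (As ! i) (?e i k)" if "i < length As" for i k
      using mat_ridem_rrst[OF assms(1) that] mat_ridem_rrst[OF assms(2) that] by simp
    have "?e i k \<perp> ?e i l" if "i < length As" "k < 2" "l < 2" "k \<noteq> l" for i k l
      using * that perp_sym by (auto simp: less_2_cases_iff)
    then obtain d where d: "block_diag As 2 ?e d"
      using block_diag_exists[OF mat_maps_sel(3)[OF assms(1)], of 2 ?e] ridem_maps[OF e] by blast
    have D: "d \<in> maps M As (concat ?R)" using d by (simp add: block_diag_def)
    note A = mat_maps_sel(3)[OF assms(1)]
    have de: "entry d i (block_start ?R k + j) = (if i = j then ?e i k else zer C (As ! i) (As ! j))"
      if "i < length As" "j < length As" "k < 2" for i j k
      using d that unfolding block_diag_def by blast
    have "mmap_cmp C d (quasiproj M ?R 0) = mmap_rst C F"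
      by (rule mat_eqI[OF mat_cmp_maps[OF D mat_quasiproj(1)[OF A]] mat_rst_maps[OF assms(1)]])
        (use entry_cmp_quasiproj[OF D, of 0] de[of _ _ 0] entry_rst[OF assms(1)] in auto)
    moreover have "mmap_cmp C d (quasiproj M ?R 1) = mmap_rst C G"
      by (rule mat_eqI[OF mat_cmp_maps[OF D mat_quasiproj(1)[OF A]] mat_rst_maps[OF assms(2)]])
        (use entry_cmp_quasiproj[OF D, of 1] de[of _ _ 1] entry_rst[OF assms(2)] in auto)
    ultimately show "perp_d M F G" unfolding perp_d using block_diag_decision[OF d e] by blast
  qed
qed

lemma mat_perp_d_iff:
  assumes "F \<in> maps M As Bs" "G \<in> maps M As Ds"
  shows "perp_d M F G \<longleftrightarrow>
    (\<forall>i<length As. \<forall>j<length Bs. \<forall>k<length Ds. entry F i j \<perp> entry G i k)"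
  using mat_perp_d_iff_rrst[OF assms]
    rrst_perp_iff[OF mat_maps_prow[OF assms(1)] mat_maps_prow[OF assms(2)]] by simp

lemma mat_perp_dE:
  assumes "perp_d M F G"
  obtains As Bs Ds where "F \<in> maps M As Bs" "G \<in> maps M As Ds"
    "\<And>i j k. i < length As \<Longrightarrow> j < length Bs \<Longrightarrow> k < length Ds \<Longrightarrow> entry F i j \<perp> entry G i k"
proof -
  have "F \<in> maps M (msrc F) (mtgt F)" "G \<in> maps M (msrc F) (mtgt G)"
    using assms by (simp_all add: perp_d_def maps_def)
  then show ?thesis using that mat_perp_d_iff assms by blast
qed

text \<open>The entries of \<open>F\<close> and \<open>G\<close> are disjoint for all pairs of
  columns, so any two terms of the products are; strength passes this to the joins.\<close>

lemma mat_cmp_right_perp: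
  assumes "F \<in> maps M As Bs" "G \<in> maps M As Ds" "K \<in> maps M Bs Bs'" "K' \<in> maps M Ds Ds'"
    "i < length As" "k < length Bs'" "l < length Ds'"
    and perp: "\<And>j j'. j < length Bs \<Longrightarrow> j' < length Ds \<Longrightarrow> entry F i j \<perp> entry G i j'"
  shows "entry (mmap_cmp C F K) i k \<perp> entry (mmap_cmp C G K') i l"
proof (rule is_join_perp_is_join[OF mat_cmp_family[OF assms(1,3,5,6)]
      entry_cmp_is_join[OF assms(1,3,5,6)] mat_cmp_family[OF assms(2,4,5,7)]
      entry_cmp_is_join[OF assms(2,4,5,7)]])
  fix j j' assume j: "j < length Bs" and j': "j' < length Ds"
  show "entry F i j \<cdot> entry K j k \<perp> entry G i j' \<cdot> entry K' j' l"
    by (rule perp_cmp_right[OF perp[OF j j'] mat_entry_maps[OF assms(1,5) j]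
          mat_entry_maps[OF assms(2,5) j'] mat_entry_maps[OF assms(3) j assms(6)]
          mat_entry_maps[OF assms(4) j' assms(7)]])
qed

text \<open>Apart from the typing axiom, everything is read off from entrywise disjointness;
  \<open>perp_rst\<close> also uses the form with row idempotents, since these are the diagonal
  entries of restrictions.\<close>

lemma mat_perp_restriction_category: "perp_restriction_category M (perp_d M)"
proof (rule perp_restriction_category.intro[OF mat_restriction_category_zeroes], unfold_locales, goal_cases)
  case (1 F G) then show ?case by (simp add: perp_d_def)
next
  case (2 As Bs)
  then have A: "set As \<subseteq> obj C" and B: "set Bs \<subseteq> obj C" by simp_all
  note I = category.ide_maps[OF mat_category 2(1)]
  note Z = restriction_category_zeroes.zer_maps[OF mat_restriction_category_zeroes 2]
  show ?case unfolding mat_perp_d_iff[OF I Z]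
  proof (intro allI impI)
    fix i j k assume i: "i < length As" and j: "j < length As" and k: "k < length Bs"
    have "Bs ! k \<in> obj C" using B k nth_mem by blast
    then show "entry (ide M As) i j \<perp> entry (zer M As Bs) i k"
      using perp_zer(1)[OF mat_entry_maps[OF I i j]] i k by simp
  qed
next
  case (3 F G)
  then obtain As Bs Ds where F: "F \<in> maps M As Bs" and G: "G \<in> maps M As Ds"
    and p: "\<And>i j k. i < length As \<Longrightarrow> j < length Bs \<Longrightarrow> k < length Ds \<Longrightarrow> entry F i j \<perp> entry G i k"
    by (rule mat_perp_dE) blast
  show ?case unfolding mat_perp_d_iff[OF G F] using p perp_sym by blast
next
  case (4 F)
  then have F: "F \<in> maps M (msrc F) (mtgt F)" by (simp add: perp_d_def maps_def)
  have z: "entry F i j = zer C (msrc F ! i) (mtgt F ! j)"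
    if "i < length (msrc F)" "j < length (mtgt F)" for i j
  proof -
    have "entry F i j \<perp> entry F i j" using 4 that unfolding mat_perp_d_iff[OF F F] by blast
    then show ?thesis using perp_self mat_entry_maps[OF F that] by (fastforce simp: maps_def)
  qed
  have "F = mk_mmap (msrc F) (mtgt F) (\<lambda>i j. zer C (msrc F ! i) (mtgt F ! j))"
    by (rule mat_eqI[OF F mat_zer_maps[OF mat_maps_sel(3,4)[OF F]]]) (simp add: z)
  then show ?case by simp
next
  case (5 F' G' F G)
  obtain As Bs Ds where F': "F' \<in> maps M As Bs" and G': "G' \<in> maps M As Ds"
    and p: "\<And>i j k. i < length As \<Longrightarrow> j < length Bs \<Longrightarrow> k < length Ds \<Longrightarrow> entry F' i j \<perp> entry G' i k"
    using 5(1) by (rule mat_perp_dE) blast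
  have F: "F \<in> maps M As Bs" and G: "G \<in> maps M As Ds"
    using F' G' restriction_category.rle_maps[OF mat_restriction_category] 5(2,3) by blast+
  show ?case unfolding mat_perp_d_iff[OF F G]
    using 5(2,3) p perp_down unfolding mat_rle_iff[OF F F'] mat_rle_iff[OF G G'] by blast
next
  case (6 F G H As' K Bs' K' Ds')
  obtain As Bs Ds where F: "F \<in> maps M As Bs" and G: "G \<in> maps M As Ds"
    and p: "\<And>i j k. i < length As \<Longrightarrow> j < length Bs \<Longrightarrow> k < length Ds \<Longrightarrow> entry F i j \<perp> entry G i k"
    using 6(1) by (rule mat_perp_dE) blast
  have H: "H \<in> maps M As' As" and K: "K \<in> maps M Bs Bs'" and K': "K' \<in> maps M Ds Ds'"
    using 6(2-4) mat_maps_sel(1,2)[OF F] mat_maps_sel(1,2)[OF G] by simp_all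
  have HF: "mmap_cmp C H F \<in> maps M As' Bs" and HG: "mmap_cmp C H G \<in> maps M As' Ds"
    using mat_cmp_maps[OF H F] mat_cmp_maps[OF H G] .
  have "perp_d M (mmap_cmp C (mmap_cmp C H F) K) (mmap_cmp C (mmap_cmp C H G) K')"
    unfolding mat_perp_d_iff[OF mat_cmp_maps[OF HF K] mat_cmp_maps[OF HG K']]
  proof (intro allI impI)
    fix i j k assume i: "i < length As'" and j: "j < length Bs'" and k: "k < length Ds'"
    show "entry (mmap_cmp C (mmap_cmp C H F) K) i j \<perp> entry (mmap_cmp C (mmap_cmp C H G) K') i k"
      by (rule mat_cmp_right_perp[OF HF HG K K' i j k mat_cmp_perp[OF H F G i _ _ p]])
  qed
  then show ?case by simp
next
  case (7 F G)
  obtain As Bs Ds where F: "F \<in> maps M As Bs" and G: "G \<in> maps M As Ds"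
    using 7 by (rule mat_perp_dE) blast
  note rF = mat_rst_maps[OF F] and rG = mat_rst_maps[OF G]
  have "perp_d M (mmap_rst C F) (mmap_rst C G)"
    unfolding mat_perp_d_iff[OF rF rG]
  proof (intro allI impI)
    fix i j k assume i: "i < length As" and j: "j < length As" and k: "k < length As"
    have p: "rrst (As ! i) Bs (\<lambda>j. entry F i j) \<perp> rrst (As ! i) Ds (\<lambda>j. entry G i j)"
      using 7 i unfolding mat_perp_d_iff_rrst[OF F G] by blast
    show "entry (mmap_rst C F) i j \<perp> entry (mmap_rst C G) i k"
    proof (cases "i = j \<and> i = k")
      case True
      then show ?thesis using p entry_rst[OF F i j] entry_rst[OF G i k] by auto
    next
      case False
      then have "entry (mmap_rst C F) i j = zer C (As ! i) (As ! j) \<or>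
          entry (mmap_rst C G) i k = zer C (As ! i) (As ! k)"
        using entry_rst[OF F i j] entry_rst[OF G i k] by auto
      then show ?thesis
        using perp_zer(1)[OF mat_entry_maps[OF rF i j] mat_src_obj[OF F k]]
          perp_zer(2)[OF mat_entry_maps[OF rG i k] mat_src_obj[OF F j]] by auto
    qed
  qed
  then show ?case by simp
qed

section \<open>Joins of disjoint matrices\<close>

lemma mat_family_entry:
  assumes "perp_family M (perp_d M) As Bs N F" "i < length As" "j < length Bs"
  shows "perp_family C perp (As ! i) (Bs ! j) N (\<lambda>k. entry (F k) i j)"
proof -
  have F: "F k \<in> maps M As Bs" if "k < N" for k using assms(1) that by (simp add: perp_family_def)
  have "set As \<subseteq> obj C" "set Bs \<subseteq> obj C" using assms(1) by (simp_all add: perp_family_def)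
  then have A: "As ! i \<in> obj C" "Bs ! j \<in> obj C" using assms(2,3) nth_mem by blast+
  have "entry (F k) i j \<perp> entry (F l) i j" if "k < N" "l < N" "k \<noteq> l" for k l
  proof -
    have "perp_d M (F k) (F l)" using assms(1) that by (simp add: perp_family_def)
    then show ?thesis using assms(2,3) unfolding mat_perp_d_iff[OF F[OF that(1)] F[OF that(2)]] by blast
  qed
  then show ?thesis using A mat_entry_maps[OF F assms(2,3)] by (simp add: perp_family_def)
qed

text \<open>Columns \<open>j\<close> and \<open>j'\<close> of the join are disjoint by strength: for
  the same member \<open>k\<close> because of its own row, for different members because
  \<open>perp_d\<close> covers all pairs of columns.\<close>

lemma mat_join_maps:
  assumes "perp_family M (perp_d M) As Bs N F"
  shows "mk_mmap As Bs (\<lambda>i j. djoin C (As ! i) (Bs ! j) N (\<lambda>k. entry (F k) i j)) \<in> maps M As Bs"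
proof (rule mat_mapsI)
  show "set As \<subseteq> obj C" and B: "set Bs \<subseteq> obj C" using assms by (simp_all add: perp_family_def)
  fix i assume i: "i < length As"
  have F: "F k \<in> maps M As Bs" if "k < N" for k using assms that by (simp add: perp_family_def)
  note fam = mat_family_entry[OF assms i]
  show "prow (As ! i) Bs (\<lambda>j. djoin C (As ! i) (Bs ! j) N (\<lambda>k. entry (F k) i j))"
    unfolding prow_def
  proof (intro conjI allI impI B)
    show "As ! i \<in> obj C" using \<open>set As \<subseteq> obj C\<close> i nth_mem by blast
    show "djoin C (As ! i) (Bs ! j) N (\<lambda>k. entry (F k) i j) \<in> maps C (As ! i) (Bs ! j)"
      if "j < length Bs" for j
      using is_join_maps[OF djoin_is_join[OF fam[OF that]]] .
    fix j j' assume j: "j < length Bs" "j' < length Bs" "j \<noteq> j'"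
    show "djoin C (As ! i) (Bs ! j) N (\<lambda>k. entry (F k) i j) \<perp>
        djoin C (As ! i) (Bs ! j') N (\<lambda>k. entry (F k) i j')"
    proof (rule is_join_perp_is_join[OF fam[OF j(1)] djoin_is_join[OF fam[OF j(1)]]
          fam[OF j(2)] djoin_is_join[OF fam[OF j(2)]]])
      fix k l assume k: "k < N" and l: "l < N"
      show "entry (F k) i j \<perp> entry (F l) i j'"
      proof (cases "k = l")
        case True
        then show ?thesis using prow_perp[OF mat_maps_prow[OF F[OF k] i] j] by simp
      next
        case False
        then have "perp_d M (F k) (F l)" using assms k l by (simp add: perp_family_def)
        then show ?thesis using i j unfolding mat_perp_d_iff[OF F[OF k] F[OF l]] by blast
      qed
    qed
  qed
qed

text \<open>Least upper bounds transfer because \<open>mat_rle_iff\<close> makes the order on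
  parallel matrices a product order.\<close>

lemma mat_is_joinI:
  assumes "S \<in> maps M As Bs" "\<And>k. k < N \<Longrightarrow> F k \<in> maps M As Bs"
    "\<And>i j. i < length As \<Longrightarrow> j < length Bs \<Longrightarrow>
      is_join C (As ! i) (Bs ! j) N (\<lambda>k. entry (F k) i j) (entry S i j)"
  shows "is_join M As Bs N F S"
  unfolding is_join_def
proof (intro conjI allI impI ballI assms(1))
  fix k assume k: "k < N"
  show "rle M (F k) S"
    unfolding mat_rle_iff[OF assms(2)[OF k] assms(1)] using is_join_upper[OF assms(3)] k by blast
next
  fix U assume U: "U \<in> maps M As Bs" and le: "\<forall>k<N. rle M (F k) U"
  show "rle M S U"
    unfolding mat_rle_iff[OF assms(1) U]
  proof (intro allI impI)
    fix i j assume i: "i < length As" and j: "j < length Bs"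
    show "rle C (entry S i j) (entry U i j)"
    proof (rule is_join_least[OF assms(3)[OF i j] mat_entry_maps[OF U i j]])
      fix k assume k: "k < N"
      then show "rle C (entry (F k) i j) (entry U i j)"
        using le i j mat_rle_iff[OF assms(2)[OF k] U] by blast
    qed
  qed
qed

lemma mat_is_join:
  assumes "perp_family M (perp_d M) As Bs N F"
  shows "is_join M As Bs N F (mk_mmap As Bs (\<lambda>i j. djoin C (As ! i) (Bs ! j) N (\<lambda>k. entry (F k) i j)))"
proof (rule mat_is_joinI[OF mat_join_maps[OF assms]])
  show "F k \<in> maps M As Bs" if "k < N" for k using assms that by (simp add: perp_family_def)
  show "is_join C (As ! i) (Bs ! j) N (\<lambda>k. entry (F k) i j)
      (entry (mk_mmap As Bs (\<lambda>i j. djoin C (As ! i) (Bs ! j) N (\<lambda>k. entry (F k) i j))) i j)"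
    if "i < length As" "j < length Bs" for i j
    using djoin_is_join[OF mat_family_entry[OF assms that]] that by simp
qed

lemma mat_djoin:
  "perp_family M (perp_d M) As Bs N F \<Longrightarrow>
    djoin M As Bs N F = mk_mmap As Bs (\<lambda>i j. djoin C (As ! i) (Bs ! j) N (\<lambda>k. entry (F k) i j))"
  by (rule restriction_category.djoin_eq[OF mat_restriction_category mat_is_join])

lemma mat_join_entry:
  assumes "perp_family M (perp_d M) As Bs N F" "is_join M As Bs N F S" "i < length As" "j < length Bs"
  shows "is_join C (As ! i) (Bs ! j) N (\<lambda>k. entry (F k) i j) (entry S i j)"
proof -
  have "S = mk_mmap As Bs (\<lambda>i j. djoin C (As ! i) (Bs ! j) N (\<lambda>k. entry (F k) i j))"
    using restriction_category.is_join_unique[OF mat_restriction_category assms(2) mat_is_join[OF assms(1)]] .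
  then show ?thesis using djoin_is_join[OF mat_family_entry[OF assms(1,3,4)]] assms(3,4) by simp
qed

text \<open>Strength is inherited entry by entry, since joins and disjointness of matrices are both
  described by entries.\<close>

lemma mat_strong_join:
  assumes "perp_family M (perp_d M) As Bs N F" "is_join M As Bs N F S"
  shows "strong_join M (perp_d M) As N F S"
  unfolding strong_join_def
proof (intro ballI impI)
  fix H assume "H \<in> arr M" "src M H = As" and p: "\<forall>k<N. perp_d M (F k) H"
  then have H: "H \<in> maps M As (mtgt H)" by (simp add: maps_def)
  have S: "S \<in> maps M As Bs" using assms(2) by (simp add: is_join_def)
  have F: "F k \<in> maps M As Bs" if "k < N" for k using assms(1) that by (simp add: perp_family_def)
  show "perp_d M S H"
    unfolding mat_perp_d_iff[OF S H]
  proof (intro allI impI)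
    fix i j l assume i: "i < length As" and j: "j < length Bs" and l: "l < length (mtgt H)"
    show "entry S i j \<perp> entry H i l"
    proof (rule is_join_perp[OF mat_family_entry[OF assms(1) i j] mat_join_entry[OF assms i j]
          mat_entry_maps[OF H i l]])
      fix k assume k: "k < N"
      then show "entry (F k) i j \<perp> entry H i l" using p i j l mat_perp_d_iff[OF F[OF k] H] by blast
    qed
  qed
qed

text \<open>An entry of \<open>H\<close> times the join is a join over the middle index of joins
  over the family; the interchange turns it into the join of the entries of the products.\<close>

lemma mat_cmp_djoin:
  assumes "perp_family M (perp_d M) As Bs N F" "H \<in> maps M Ds As"
  shows "mmap_cmp C H (djoin M As Bs N F) = djoin M Ds Bs N (\<lambda>k. mmap_cmp C H (F k))"
proof -
  define S where "S = djoin M As Bs N F"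
  have S: "is_join M As Bs N F S" unfolding S_def using mat_djoin[OF assms(1)] mat_is_join[OF assms(1)] by simp
  then have Sm: "S \<in> maps M As Bs" by (simp add: is_join_def)
  have F: "F k \<in> maps M As Bs" if "k < N" for k using assms(1) that by (simp add: perp_family_def)
  have "is_join M Ds Bs N (\<lambda>k. mmap_cmp C H (F k)) (mmap_cmp C H S)"
  proof (rule mat_is_joinI[OF mat_cmp_maps[OF assms(2) Sm] mat_cmp_maps[OF assms(2) F]])
    fix i j assume i: "i < length Ds" and j: "j < length Bs"
    show "is_join C (Ds ! i) (Bs ! j) N (\<lambda>k. entry (mmap_cmp C H (F k)) i j) (entry (mmap_cmp C H S) i j)"
    proof (rule is_join_swap[OF _ entry_cmp_is_join[OF assms(2) Sm i j]])
      show "is_join C (Ds ! i) (Bs ! j) N (\<lambda>k. entry H i l \<cdot> entry (F k) l j) (entry H i l \<cdot> entry S l j)"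
        if "l < length As" for l
        by (rule is_join_cmp_left[OF mat_family_entry[OF assms(1) that j]
              mat_join_entry[OF assms(1) S that j] mat_entry_maps[OF assms(2) i that]])
      show "is_join C (Ds ! i) (Bs ! j) (length As) (\<lambda>l. entry H i l \<cdot> entry (F k) l j)
          (entry (mmap_cmp C H (F k)) i j)" if "k < N" for k
        by (rule entry_cmp_is_join[OF assms(2) F[OF that] i j])
    qed
  qed
  then show ?thesis
    using restriction_category.djoin_eq[OF mat_restriction_category] unfolding S_def by metis
qed

lemma mat_finitely_disjoint_restriction_category:
  "finitely_disjoint_restriction_category M (perp_d M)"
proof (rule finitely_disjoint_restriction_category.intro[OF mat_perp_restriction_category],
    unfold_locales, goal_cases)
  case (1 As Bs N F) then show ?case using mat_is_join by blast
next
  case 2 then show ?case using mat_cmp_djoin[OF 2] by simp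
next
  case 3 then show ?case by (rule mat_strong_join)
qed

section \<open>The embedding by one-by-one matrices\<close>

lemma entry_incl_map [simp]: "entry (incl_map C f) 0 0 = f"
  by (simp add: incl_map_def)

lemma incl_map_maps:
  assumes "f \<in> maps C A B" shows "incl_map C f \<in> maps M [A] [B]"
proof -
  have "src C f = A" "tgt C f = B" using assms by (auto simp: maps_def)
  then have *: "incl_map C f = mk_mmap [A] [B] (\<lambda>_ _. f)" by (simp add: incl_map_def)
  show ?thesis unfolding * by (rule mat_mapsI)
      (use assms maps_src_obj[OF assms] maps_tgt_obj[OF assms] in \<open>auto simp: prow_def\<close>)
qed

lemma mat_single_eqI:
  "F \<in> maps M [A] [B] \<Longrightarrow> G \<in> maps M [A] [B] \<Longrightarrow> entry F 0 0 = entry G 0 0 \<Longrightarrow> F = G"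
  by (rule mat_eqI) auto

lemma incl_map_perp:
  assumes "f \<perp> g" shows "perp_d M (incl_map C f) (incl_map C g)"
proof -
  have "f \<in> maps C (src C f) (tgt C f)" "g \<in> maps C (src C f) (tgt C g)"
    using perp_same_src[OF assms] by (auto simp: maps_def)
  then show ?thesis using mat_perp_d_iff[OF incl_map_maps incl_map_maps] assms by simp
qed

text \<open>Products and restrictions of one-by-one matrices involve joins over a single index,
  which equal their only member; joins are preserved because \<open>mat_djoin\<close> computes them
  in the single entry.\<close>

lemma incl_map_functor:
  "finitely_disjoint_interference_functor C perp M (perp_d M) (\<lambda>A. [A]) (incl_map C)"
proof (intro finitely_disjoint_interference_functor.intro
    finitely_disjoint_interference_functor_axioms.intro, goal_cases)
  case 1 show ?case by (rule finitely_disjoint_restriction_category_axioms)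
next
  case 2 show ?case by (rule mat_finitely_disjoint_restriction_category)
next
  case 3 then show ?case by simp
next
  case 4 then show ?case by (rule incl_map_maps)
next
  case (5 A)
  have "[A] \<in> obj M" using 5 by simp
  from category.ide_maps[OF mat_category this] show ?case
    by (rule mat_single_eqI[OF incl_map_maps[OF ide_maps[OF 5]]]) simp
next
  case (6 f A B g E)
  note f = incl_map_maps[OF 6(1)] and g = incl_map_maps[OF 6(2)]
  have "incl_map C (f \<cdot> g) = mmap_cmp C (incl_map C f) (incl_map C g)"
  proof (rule mat_single_eqI[OF incl_map_maps[OF cmp_maps[OF 6]] mat_cmp_maps[OF f g]])
    have "is_join C A E 1 (\<lambda>j. entry (incl_map C f) 0 j \<cdot> entry (incl_map C g) j 0)
        (entry (mmap_cmp C (incl_map C f) (incl_map C g)) 0 0)"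
      using entry_cmp_is_join[OF f g, of 0 0] by simp
    moreover have "is_join C A E 1 (\<lambda>j. entry (incl_map C f) 0 j \<cdot> entry (incl_map C g) j 0) (f \<cdot> g)"
      by (rule is_join_single[of 0]) (use cmp_maps[OF 6] in auto)
    ultimately show "entry (incl_map C (f \<cdot> g)) 0 0 =
        entry (mmap_cmp C (incl_map C f) (incl_map C g)) 0 0"
      using is_join_unique by simp
  qed
  then show ?case by simp
next
  case (7 f)
  then obtain A B where f: "f \<in> maps C A B" by (auto simp: maps_def)
  note If = incl_map_maps[OF f]
  have "incl_map C (rst C f) = mmap_rst C (incl_map C f)"
  proof (rule mat_single_eqI[OF incl_map_maps[OF rst_maps[OF f]] mat_rst_maps[OF If]])
    have "is_join C A A 1 (\<lambda>j. rst C (entry (incl_map C f) 0 j)) (rrst A [B] (\<lambda>j. entry (incl_map C f) 0 j))"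
      using rrst_is_join[OF mat_maps_prow[OF If, of 0]] by simp
    moreover have "is_join C A A 1 (\<lambda>j. rst C (entry (incl_map C f) 0 j)) (rst C f)"
      by (rule is_join_single[of 0]) (use rst_maps[OF f] in auto)
    ultimately show "entry (incl_map C (rst C f)) 0 0 = entry (mmap_rst C (incl_map C f)) 0 0"
      using is_join_unique entry_rst[OF If, of 0 0] by simp
  qed
  then show ?case by simp
next
  case (8 A B)
  have "[A] \<in> obj M" "[B] \<in> obj M" using 8 by simp_all
  from restriction_category_zeroes.zer_maps[OF mat_restriction_category_zeroes this] show ?case
    by (rule mat_single_eqI[OF incl_map_maps[OF zer_maps[OF 8]]]) simp
next
  case 9 then show ?case by (rule incl_map_perp)
next
  case (10 A B n fs)
  have fam: "perp_family M (perp_d M) [A] [B] n (\<lambda>i. incl_map C (fs i))"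
    using 10 incl_map_maps incl_map_perp by (simp add: perp_family_def)
  have J: "djoin C A B n fs \<in> maps C A B" by (rule is_join_maps[OF djoin_is_join[OF 10]])
  show ?case unfolding mat_djoin[OF fam]
    by (rule mat_single_eqI[OF incl_map_maps[OF J] mat_join_maps[OF fam]]) simp
qed

end

theorem proposition8p2:
  fixes X :: "('o, 'm, 'x) zcat_scheme" and perp :: "'m \<Rightarrow> 'm \<Rightarrow> bool"
  assumes "finitely_disjoint_restriction_category X perp"
  shows "extensive_restriction_category (MAT X perp) \<and>
    (\<forall>As Bs N F S.
      perp_family (MAT X perp) (perp_d (MAT X perp)) As Bs N F \<longrightarrow>
      is_join (MAT X perp) As Bs N F S \<longrightarrow>
      strong_join (MAT X perp) (perp_d (MAT X perp)) As N F S) \<and>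
    finitely_disjoint_restriction_category (MAT X perp) (perp_d (MAT X perp)) \<and>
    (\<forall>As Bs Cs. \<forall>F\<in>maps (MAT X perp) As Bs. \<forall>G\<in>maps (MAT X perp) As Cs.
      perp_d (MAT X perp) F G \<longleftrightarrow>
      (\<forall>i<length As. \<forall>j<length Bs. \<forall>k<length Cs. perp (entry F i j) (entry G i k))) \<and>
    (\<forall>As Bs N F.
      perp_family (MAT X perp) (perp_d (MAT X perp)) As Bs N F \<longrightarrow>
      djoin (MAT X perp) As Bs N F =
      mk_mmap As Bs (\<lambda>i j. djoin X (As ! i) (Bs ! j) N (\<lambda>k. entry (F k) i j))) \<and>
    finitely_disjoint_interference_functor X perp (MAT X perp) (perp_d (MAT X perp))
      (\<lambda>A. [A]) (incl_map X)"
proof -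
  interpret finitely_disjoint_restriction_category X perp by fact
  show ?thesis
    using mat_extensive_restriction_category mat_strong_join
      mat_finitely_disjoint_restriction_category mat_perp_d_iff mat_djoin incl_map_functor by blast
qed

end
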